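(* For each real $\ell>0$ and each real $\theta>0$, there exist a (strictly) increasing infinite sequence of primes $(p_k)_{k\ge 1}$ and a constant $c>0$ such that $$\sum_{k} \frac{1}{p_k} = \ell \quad\text{and}\quad p_k \ge c\,\theta^k \text{ for all } k,$$ and, in particular, such that $\sum_k \frac{1}{p_k^{\alpha}}<\infty$ for all real $\alpha>0$. *)

theory Defs
  imports Complex_Main "HOL-Computational_Algebra.Primes"
begin

end

theory Submission
  imports
    Defs
    "HOL-Number_Theory.Prime_Powers"
    "HOL-Computational_Algebra.Squarefree"
    "HOL-Analysis.Summation_Tests"
begin

text \<open>
  The sequence is obtained greedily. If \<open>s\<close> is what remains of \<open>l\<close>, the next prime \<open>p\<close> is chosen
  just above \<open>1 / s\<close>, and the new remainder is \<open>s - 1 / p\<close>. When \<open>p \<le> (1 + \<epsilon>) / s\<close>, the new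
  remainder is at most \<open>\<epsilon> * s\<close>, so with \<open>\<epsilon> = 1 / \<Theta>\<close> the primes grow like \<open>\<Theta> ^ k\<close>
  (\<open>greedy_prime_reciprocals\<close>). To enter the range where such primes exist, finitely many consecutive
  primes are used first, which is possible because the sum of the reciprocals of the primes diverges
  (\<open>ex_initial_primes\<close>).

  All of this rests on the fact that for each \<open>\<epsilon> > 0\<close> and all large \<open>x\<close> there is a prime between \<open>x\<close>
  and \<open>(1 + \<epsilon>) * x\<close> (\<open>ex_prime_short_interval\<close>). The proof is the elementary one of Selberg and Erdos.
  Selberg's formula, in a form weighted by \<open>1 / n\<close> (\<open>mertens_and_selberg\<close>, \<open>selberg_window\<close>), relates
  the mass \<open>\<Lambda> n / n\<close> in a short window at \<open>x\<close> to the average mass in the windows at \<open>x / n\<close>. It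
  bounds the density of this mass by 2, and it shows that a nearly empty window at \<open>x\<close> forces nearly
  all windows at \<open>x / n\<close> to have density 2. Erdos's argument (\<open>window_mass_shrink\<close>) derives from this
  an interval in which the mean density is close to \<open>3 / 2\<close>, in conflict with Mertens' theorem, by
  which the mean density is 1.
\<close>

section \<open>Sums over initial segments and Moebius inversion\<close>

definition nats_upto :: "real \<Rightarrow> nat set" where
  "nats_upto x = {n. 0 < n \<and> real n \<le> x}"

lemma nats_upto_altdef: "nats_upto x = {1..nat \<lfloor>x\<rfloor>}"
proof (intro equalityI subsetI)
  fix n assume "n \<in> {1..nat \<lfloor>x\<rfloor>}"
  hence "0 < n" "int n \<le> \<lfloor>x\<rfloor>" by auto
  thus "n \<in> nats_upto x" by (simp add: nats_upto_def le_floor_iff)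
qed (auto simp: nats_upto_def intro: le_nat_floor)

lemma finite_nats_upto [simp, intro]: "finite (nats_upto x)"
  by (simp add: nats_upto_altdef)

lemma card_nats_upto_le: "x \<ge> 0 \<Longrightarrow> real (card (nats_upto x)) \<le> x"
  by (simp add: nats_upto_altdef)

lemma nats_upto_mono: "x \<le> y \<Longrightarrow> nats_upto x \<subseteq> nats_upto y"
  by (auto simp: nats_upto_def)

lemma sum_nats_upto_convolution:
  fixes f :: "nat \<Rightarrow> nat \<Rightarrow> real"
  shows "(\<Sum>d\<in>nats_upto x. \<Sum>n\<in>nats_upto (x / d). f d n)
       = (\<Sum>m\<in>nats_upto x. \<Sum>d | d dvd m. f d (m div d))"
proof -
  have "(\<Sum>d\<in>nats_upto x. \<Sum>n\<in>nats_upto (x / d). f d n)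
      = (\<Sum>(d,n)\<in>Sigma (nats_upto x) (\<lambda>d. nats_upto (x / d)). f d n)"
    by (subst sum.Sigma) auto
  also have "\<dots> = (\<Sum>(m,d)\<in>Sigma (nats_upto x) (\<lambda>m. {d. d dvd m}). f d (m div d))"
    by (rule sum.reindex_bij_witness[where i = "\<lambda>(m,d). (d, m div d)" and j = "\<lambda>(d,n). (d * n, d)"])
       (auto simp: nats_upto_def field_simps dvd_div_eq_0_iff elim!: dvdE
             intro: order.trans[rotated] mult_le_cancel_left1)
  also have "\<dots> = (\<Sum>m\<in>nats_upto x. \<Sum>d | d dvd m. f d (m div d))"
    by (subst sum.Sigma) (simp_all, auto simp: nats_upto_def)
  finally show ?thesis .
qed

text \<open>
  Both sides run over the pairs \<open>(d, e)\<close> with \<open>d * e dvd m\<close>.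
\<close>

lemma sum_divisors_swap:
  fixes f :: "nat \<Rightarrow> nat \<Rightarrow> real"
  assumes "m > 0"
  shows "(\<Sum>d | d dvd m. \<Sum>e | e dvd m div d. f d e)
       = (\<Sum>e | e dvd m. \<Sum>d | d dvd m div e. f d e)"
proof -
  have fin: "finite {d. d dvd k}" if "k dvd m" for k
    using assms that by (auto intro!: finite_divisors_nat dest: dvd_pos_nat)
  have fin': "finite {e. e dvd m div d}" if "d dvd m" for d
    by (rule fin) (use that in \<open>auto elim!: dvdE\<close>)
  have "(\<Sum>d | d dvd m. \<Sum>e | e dvd m div d. f d e)
      = (\<Sum>(d,e)\<in>Sigma {d. d dvd m} (\<lambda>d. {e. e dvd m div d}). f d e)"
    by (subst sum.Sigma) (use fin fin' in auto)
  also have "\<dots> = (\<Sum>(e,d)\<in>Sigma {d. d dvd m} (\<lambda>d. {e. e dvd m div d}). f d e)"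
  proof (rule sum.reindex_bij_witness[where i = prod.swap and j = prod.swap], goal_cases)
    case (2 a)
    then show ?case using assms by (auto elim!: dvdE simp: mult_ac)
  next
    case (4 a)
    then show ?case using assms by (auto elim!: dvdE simp: mult_ac)
  qed auto
  also have "\<dots> = (\<Sum>e | e dvd m. \<Sum>d | d dvd m div e. f d e)"
    by (subst sum.Sigma) (use fin fin' in auto)
  finally show ?thesis .
qed

definition mobius :: "nat \<Rightarrow> real" where
  "mobius n = (if squarefree n then (-1) ^ card (prime_factors n) else 0)"

lemma abs_mobius_le: "\<bar>mobius n\<bar> \<le> 1"
  by (auto simp: mobius_def)

lemma mobius_1 [simp]: "mobius (Suc 0) = 1"
  by (simp add: mobius_def)

text \<open>
  The sign flip behind the cancellation in \<open>sum_mobius_divisors\<close>.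
\<close>

lemma mobius_prime_mult:
  assumes "prime p" "\<not> p dvd d" "d > 0"
  shows "mobius (p * d) = - mobius d"
proof -
  have cop: "coprime p d" using assms by (simp add: prime_imp_coprime)
  have sf: "squarefree (p * d) \<longleftrightarrow> squarefree d"
    using squarefree_mult_coprime[OF cop] squarefree_multD[of p d] assms(1)
    by (auto simp: squarefree_prime)
  have "prime_factors (p * d) = insert p (prime_factors d)"
    using assms by (subst prime_factors_product) (auto simp: prime_prime_factors)
  moreover have "p \<notin> prime_factors d" using assms by auto
  ultimately show ?thesis by (simp add: mobius_def sf)
qed

text \<open>
  For \<open>n > 1\<close> a fixed prime factor \<open>p\<close> of \<open>n\<close> pairs each squarefree divisor \<open>d\<close> prime to \<open>p\<close>
  with \<open>p * d\<close>, and the two terms cancel.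
\<close>

lemma sum_mobius_divisors:
  assumes "n > 0"
  shows "(\<Sum>d | d dvd n. mobius d) = (if n = 1 then 1 else 0)"
proof (cases "n = 1")
  case False
  then obtain p where p: "prime p" "p dvd n" using prime_factor_nat by blast
  have fin: "finite {d. d dvd n}" using assms by simp
  define S where "S = {d. d dvd n \<and> squarefree d}"
  have finS: "finite S" using fin by (simp add: S_def)
  have "(\<Sum>d | d dvd n. mobius d) = sum mobius S"
    by (rule sum.mono_neutral_right) (use fin in \<open>auto simp: S_def mobius_def\<close>)
  also have "\<dots> = sum mobius (S \<inter> {d. \<not> p dvd d}) + sum mobius (S \<inter> {d. p dvd d})"
    using finS by (subst sum.union_disjoint [symmetric]) (auto intro!: sum.cong)
  also have "sum mobius (S \<inter> {d. p dvd d}) = (\<Sum>d\<in>S \<inter> {d. \<not> p dvd d}. mobius (p * d))"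
  proof (rule sum.reindex_bij_witness[where i = "\<lambda>d. p * d" and j = "\<lambda>d. d div p"], goal_cases)
    case (2 d)
    then obtain e where e: "d = p * e" by (auto elim: dvdE)
    have sf: "squarefree (p * e)" and dv: "p * e dvd n" using 2 e by (auto simp: S_def)
    have "\<not> p dvd e"
    proof
      assume "p dvd e"
      hence "p ^ 2 dvd p * e" by (simp add: power2_eq_square)
      with sf have "is_unit p" by (auto dest: squarefreeD)
      with p(1) show False by simp
    qed
    then show ?case using sf dv e p(1) 
      by (auto simp: S_def dest: squarefree_multD dvd_mult_right prime_gt_0_nat)
  next
    case (4 d)
    then have "coprime p d" using p by (auto intro: prime_imp_coprime)
    then show ?case using 4 p 
      by (auto simp: S_def divides_mult squarefree_prime intro!: squarefree_mult_coprime)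
  qed (use p in \<open>auto simp: prime_gt_0_nat\<close>)
  also have "\<dots> = - sum mobius (S \<inter> {d. \<not> p dvd d})"
    unfolding sum_negf [symmetric]
    by (intro sum.cong refl mobius_prime_mult) 
       (use p assms in \<open>auto simp: S_def dest: dvd_pos_nat\<close>)
  finally show ?thesis using False by simp
qed simp_all

abbreviation \<Lambda> :: "nat \<Rightarrow> real" where "\<Lambda> \<equiv> mangoldt"

text \<open>
  The weight \<open>ln (x / d)\<close> is what brings the von Mangoldt function into Selberg's formula:
  inverting \<open>ln m = (\<Sum>d | d dvd m. \<Lambda> d)\<close> gives
  \<open>(\<Sum>d | d dvd m. mobius d * ln (m / d)) = \<Lambda> m\<close>, and replacing \<open>m\<close> by \<open>x\<close> adds
  \<open>ln (x / m)\<close> times a sum that vanishes unless \<open>m = 1\<close>.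
\<close>

lemma sum_mobius_ln_divisors:
  assumes "m > 0" "x > 0"
  shows "(\<Sum>d | d dvd m. mobius d * ln (x / d)) = (if m = 1 then ln x else 0) + \<Lambda> m"
proof -
  have fin: "finite {d. d dvd m}" using assms by simp
  have "(\<Sum>d | d dvd m. mobius d * ln (m div d))
      = (\<Sum>d | d dvd m. \<Sum>e | e dvd m div d. mobius d * \<Lambda> e)"
    using assms by (intro sum.cong refl)
      (auto simp: mangoldt_sum dvd_div_eq_0_iff simp flip: sum_distrib_left)
  also have "\<dots> = (\<Sum>e | e dvd m. \<Sum>d | d dvd m div e. mobius d * \<Lambda> e)"
    by (rule sum_divisors_swap) fact
  also have "\<dots> = (\<Sum>e | e dvd m. if e = m then \<Lambda> e else 0)"
  proof (intro sum.cong refl)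
    fix e assume e: "e \<in> {e. e dvd m}"
    then obtain k where k: "m = e * k" by (auto elim: dvdE)
    with assms have "e > 0" "k > 0" by auto
    have "(\<Sum>d | d dvd m div e. mobius d * \<Lambda> e) = (\<Sum>d | d dvd k. mobius d) * \<Lambda> e"
      using k \<open>e > 0\<close> by (simp add: sum_distrib_right)
    also have "\<dots> = (if e = m then \<Lambda> e else 0)"
      using k \<open>e > 0\<close> \<open>k > 0\<close> by (simp add: sum_mobius_divisors)
    finally show "(\<Sum>d | d dvd m div e. mobius d * \<Lambda> e) = (if e = m then \<Lambda> e else 0)" .
  qed
  also have "\<dots> = \<Lambda> m" using fin by (subst sum.delta) auto
  finally have 1: "(\<Sum>d | d dvd m. mobius d * ln (m div d)) = \<Lambda> m" .
  have "(\<Sum>d | d dvd m. mobius d * ln (x / d))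
      = (\<Sum>d | d dvd m. mobius d * ln (x / m) + mobius d * ln (m div d))"
  proof (intro sum.cong refl)
    fix d assume "d \<in> {d. d dvd m}"
    then obtain k where k: "m = d * k" by (auto elim: dvdE)
    with assms have "d > 0" "k > 0" by auto
    have "ln (x / d) = ln (x / m) + ln (m div d)"
      using k \<open>d > 0\<close> \<open>k > 0\<close> assms by (simp add: ln_div ln_mult)
    thus "mobius d * ln (x / d) = mobius d * ln (x / m) + mobius d * ln (m div d)"
      by (simp add: algebra_simps)
  qed
  also have "\<dots> = (\<Sum>d | d dvd m. mobius d) * ln (x / m) + \<Lambda> m"
    by (simp add: sum.distrib sum_distrib_right 1)
  also have "\<dots> = (if m = 1 then ln x else 0) + \<Lambda> m"
    using assms by (simp add: sum_mobius_divisors)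
  finally show ?thesis .
qed

text \<open>
  With \<open>w = (\<lambda>_. 1)\<close> this is ordinary Moebius inversion; with \<open>w d = ln (x / d)\<close> it is the
  identity of Tatuzawa and Iseki.
\<close>

lemma mobius_inversion_weighted:
  fixes g :: "real \<Rightarrow> real" and w :: "nat \<Rightarrow> real"
  shows "(\<Sum>d\<in>nats_upto x. mobius d / d * w d * (\<Sum>n\<in>nats_upto (x / d). g (x / d / n) / n))
       = (\<Sum>m\<in>nats_upto x. g (x / m) / m * (\<Sum>d | d dvd m. mobius d * w d))"
proof -
  have "(\<Sum>d\<in>nats_upto x. mobius d / d * w d * (\<Sum>n\<in>nats_upto (x / d). g (x / d / n) / n))
      = (\<Sum>d\<in>nats_upto x. \<Sum>n\<in>nats_upto (x / d). g (x / real (d * n)) / (d * n) * (mobius d * w d))"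
    by (auto simp: sum_distrib_left field_simps intro!: sum.cong)
  also have "\<dots> = (\<Sum>m\<in>nats_upto x. \<Sum>d | d dvd m. g (x / real (d * (m div d))) / (d * (m div d)) * (mobius d * w d))"
    by (rule sum_nats_upto_convolution)
  also have "\<dots> = (\<Sum>m\<in>nats_upto x. g (x / m) / m * (\<Sum>d | d dvd m. mobius d * w d))"
    unfolding sum_distrib_left by (intro sum.cong refl) simp
  finally show ?thesis .
qed

lemma mobius_inversion:
  fixes g :: "real \<Rightarrow> real"
  assumes "x \<ge> 1"
  shows "(\<Sum>d\<in>nats_upto x. mobius d / d * (\<Sum>n\<in>nats_upto (x / d). g (x / d / n) / n)) = g x"
proof -
  have "(\<Sum>d\<in>nats_upto x. mobius d / d * (\<Sum>n\<in>nats_upto (x / d). g (x / d / n) / n))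
      = (\<Sum>m\<in>nats_upto x. g (x / m) / m * (\<Sum>d | d dvd m. mobius d))"
    using mobius_inversion_weighted[where x = x and g = g and w = "\<lambda>_. 1"] by simp
  also have "\<dots> = (\<Sum>m\<in>nats_upto x. if m = 1 then g x else 0)"
    by (intro sum.cong refl) (auto simp: nats_upto_def sum_mobius_divisors)
  also have "\<dots> = g x" using assms by (subst sum.delta) (simp_all, simp add: nats_upto_def)
  finally show ?thesis .
qed

lemma sum_inverse_sqrt_le: "(\<Sum>k=1..n. 1 / sqrt (real k)) \<le> 2 * sqrt (real n)"
proof (induction n)
  case (Suc n)
  have "1 / sqrt (real (Suc n)) \<le> 2 * (sqrt (real (Suc n)) - sqrt (real n))"
  proof -
    have pos: "sqrt (real (Suc n)) > 0" by simp
    have "2 * sqrt (real n) * sqrt (real (Suc n)) \<le> sqrt (real n) ^ 2 + sqrt (real (Suc n)) ^ 2"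
      by (rule sum_squares_bound)
    hence "1 + 2 * sqrt (real n) * sqrt (real (Suc n)) \<le> 2 * sqrt (real (Suc n)) ^ 2" by simp
    thus ?thesis using pos by (simp add: field_simps power2_eq_square)
  qed
  with Suc.IH show ?case by simp
qed simp

text \<open>
  The sum of \<open>1 / sqrt d\<close> over \<open>d \<le> x\<close> is at most \<open>2 * sqrt x\<close>, so an error term
  that saves a factor \<open>sqrt y\<close> contributes a bounded error after inversion.
\<close>

lemma mobius_sum_error_bound:
  fixes h :: "real \<Rightarrow> real"
  assumes h: "\<And>y. y \<ge> 1 \<Longrightarrow> \<bar>h y\<bar> \<le> C / sqrt y" and "x \<ge> 1"
  shows "\<bar>\<Sum>d\<in>nats_upto x. mobius d / d * h (x / d)\<bar> \<le> 2 * C"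
proof -
  have "C \<ge> 0" using h[of 1] by simp
  have "\<bar>\<Sum>d\<in>nats_upto x. mobius d / d * h (x / d)\<bar>
      \<le> (\<Sum>d\<in>nats_upto x. \<bar>mobius d / d * h (x / d)\<bar>)" by (rule sum_abs)
  also have "\<dots> \<le> (\<Sum>d\<in>nats_upto x. C / sqrt x * (1 / sqrt d))"
  proof (intro sum_mono)
    fix d assume d: "d \<in> nats_upto x"
    hence "d > 0" "x / d \<ge> 1" by (auto simp: nats_upto_def)
    have "\<bar>mobius d / d * h (x / d)\<bar> = \<bar>mobius d\<bar> * (\<bar>h (x / d)\<bar> / d)"
      by (simp add: abs_mult)
    also have "\<dots> \<le> 1 * (C / sqrt (x / d) / d)"
      using h[of "x / d"] \<open>x / d \<ge> 1\<close> abs_mobius_le[of d] \<open>C \<ge> 0\<close>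
      by (intro mult_mono divide_right_mono) auto
    also have "\<dots> = C / sqrt x * (sqrt d / d)"
      by (simp add: real_sqrt_divide)
    also have "sqrt d / d = 1 / sqrt d"
      using \<open>d > 0\<close> by (simp add: real_div_sqrt divide_simps)
    finally show "\<bar>mobius d / d * h (x / d)\<bar> \<le> C / sqrt x * (1 / sqrt d)" .
  qed
  also have "\<dots> = C / sqrt x * (\<Sum>d\<in>nats_upto x. 1 / sqrt d)"
    by (simp add: sum_distrib_left)
  also have "\<dots> \<le> C / sqrt x * (2 * sqrt x)"
  proof (intro mult_left_mono)
    have "(\<Sum>d\<in>nats_upto x. 1 / sqrt d) \<le> 2 * sqrt (nat \<lfloor>x\<rfloor>)"
      using sum_inverse_sqrt_le[of "nat \<lfloor>x\<rfloor>"] by (simp add: nats_upto_altdef)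
    also have "\<dots> \<le> 2 * sqrt x" using assms(2) by simp
    finally show "(\<Sum>d\<in>nats_upto x. 1 / sqrt d) \<le> 2 * sqrt x" .
  qed (use \<open>C \<ge> 0\<close> assms in auto)
  also have "\<dots> = 2 * C" using assms(2) by simp
  finally show ?thesis .
qed

text \<open>
  The integers \<open>\<lfloor>x / d\<rfloor>\<close> satisfy \<open>(\<Sum>d\<le>x. mobius d * \<lfloor>x / d\<rfloor>) = 1\<close> by inversion, and dropping
  the floors changes each term by at most 1.
\<close>

lemma abs_sum_mobius_over_le:
  assumes "x \<ge> 1"
  shows "\<bar>\<Sum>d\<in>nats_upto x. mobius d / d\<bar> \<le> 2"
proof -
  have "(\<Sum>d\<in>nats_upto x. mobius d / d * (\<Sum>n\<in>nats_upto (x / d). 1 / (x / d / n) / n)) = 1 / x"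
    by (rule mobius_inversion[OF assms])
  moreover have "(\<Sum>n\<in>nats_upto (x / d). 1 / (x / d / n) / n) = d / x * card (nats_upto (x / d))" for d :: nat
    by (auto simp: nats_upto_def)
  ultimately have eq: "(\<Sum>d\<in>nats_upto x. mobius d / d * (d / x * card (nats_upto (x / d)))) = 1 / x"
    by (simp only:)
  have "(\<Sum>d\<in>nats_upto x. mobius d * (x / d - card (nats_upto (x / d))))
      = x * (\<Sum>d\<in>nats_upto x. mobius d / d)
        - x * (\<Sum>d\<in>nats_upto x. mobius d / d * (d / x * card (nats_upto (x / d))))"
    unfolding sum_distrib_left sum_subtractf [symmetric]
    by (intro sum.cong refl) (use assms in \<open>auto simp: nats_upto_def field_simps\<close>)
  also have "\<dots> = x * (\<Sum>d\<in>nats_upto x. mobius d / d) - 1"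
    unfolding eq using assms by simp
  finally have eq2: "x * (\<Sum>d\<in>nats_upto x. mobius d / d)
      = 1 + (\<Sum>d\<in>nats_upto x. mobius d * (x / d - card (nats_upto (x / d))))" by simp
  have "\<bar>\<Sum>d\<in>nats_upto x. mobius d * (x / d - card (nats_upto (x / d)))\<bar> 
      \<le> (\<Sum>d\<in>nats_upto x. \<bar>mobius d * (x / d - card (nats_upto (x / d)))\<bar>)" by (rule sum_abs)
  also have "\<dots> \<le> (\<Sum>d\<in>nats_upto x. 1 * 1)"
  proof (intro sum_mono)
    fix d assume "d \<in> nats_upto x"
    have "real (card (nats_upto (x / d))) = of_int \<lfloor>x / d\<rfloor>"
      using assms by (simp add: nats_upto_altdef)
    hence "\<bar>x / d - card (nats_upto (x / d))\<bar> \<le> 1" by linarith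
    with abs_mobius_le[of d] show "\<bar>mobius d * (x / d - card (nats_upto (x / d)))\<bar> \<le> 1 * 1"
      unfolding abs_mult by (intro mult_mono) auto
  qed
  also have "\<dots> \<le> x" using card_nats_upto_le[of x] assms by simp
  finally have "\<bar>x * (\<Sum>d\<in>nats_upto x. mobius d / d)\<bar> \<le> 1 + x"
    unfolding eq2 by linarith
  also have "\<dots> \<le> x * 2" using assms by simp
  finally show ?thesis using assms by (simp add: abs_mult)
qed

section \<open>The formulas of Mertens and Selberg\<close>

text \<open>
  The difference between the sum and the antiderivative decreases at the integers, and it
  increases once the last summand is removed; since that summand tends to 0, the two bounds
  enclose a common limit \<open>c\<close>.
\<close>

lemma antimono_sum_asymptotics:
  fixes f F :: "real \<Rightarrow> real" and N :: nat
  assumes deriv: "\<And>t. t \<ge> real N \<Longrightarrow> (F has_real_derivative f t) (at t)"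
    and anti: "\<And>s t. real N \<le> s \<Longrightarrow> s \<le> t \<Longrightarrow> f t \<le> f s"
    and lim: "(\<lambda>n. f (real n)) \<longlonglongrightarrow> 0"
  shows "\<exists>c. \<forall>y\<ge>real N. \<bar>(\<Sum>k\<in>nats_upto y. f k) - F y - c\<bar> \<le> f (nat \<lfloor>y\<rfloor>)"
proof -
  have mvt: "f t * (t - s) \<le> F t - F s \<and> F t - F s \<le> f s * (t - s)"
    if "real N \<le> s" "s \<le> t" for s t
  proof (cases "s = t")
    case False
    with that have "s < t" by simp
    then have "\<exists>z>s. z < t \<and> F t - F s = (t - s) * f z"
      by (rule MVT2) (use deriv that in auto)
    then obtain z where z: "s < z" "z < t" "F t - F s = (t - s) * f z"
      by blast
    have "f t \<le> f z" "f z \<le> f s" using anti that z by auto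
    thus ?thesis using z(3) \<open>s < t\<close> by (simp add: mult.commute)
  qed simp
  have nonneg: "f s \<ge> 0" if "s \<ge> real N" for s
  proof (rule LIMSEQ_le_const2[OF lim], intro exI allI impI)
    fix n assume "n \<ge> nat \<lceil>s\<rceil>"
    thus "f (real n) \<le> f s" using that by (intro anti) linarith+
  qed
  define a where "a n = (\<Sum>k=1..n. f k) - F n" for n :: nat
  have a_Suc: "a (Suc n) = a n + f (Suc n) - (F (Suc n) - F n)" for n
    by (simp add: a_def)
  have step: "f (Suc n) \<le> F (Suc n) - F n" "F (Suc n) - F n \<le> f n" if "n \<ge> N" for n
    using mvt[of n "Suc n"] that by simp_all
  obtain c where c: "\<And>n. a (n + N) - f (n + N) \<le> c" "\<And>n. c \<le> a (n + N)"
  proof -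
    have "\<exists>c. ((\<forall>n. a (n + N) - f (n + N) \<le> c) \<and> (\<lambda>n. a (n + N) - f (n + N)) \<longlonglongrightarrow> c) \<and>
              ((\<forall>n. c \<le> a (n + N)) \<and> (\<lambda>n. a (n + N)) \<longlonglongrightarrow> c)"
    proof (rule nested_sequence_unique)
      show "\<forall>n. a (n + N) - f (n + N) \<le> a (Suc n + N) - f (Suc n + N)"
      proof
        fix n show "a (n + N) - f (n + N) \<le> a (Suc n + N) - f (Suc n + N)"
          using step(2)[of "n + N"] a_Suc[of "n + N"] by (simp del: of_nat_Suc)
      qed
      show "\<forall>n. a (Suc n + N) \<le> a (n + N)"
      proof
        fix n show "a (Suc n + N) \<le> a (n + N)"
          using step(1)[of "n + N"] a_Suc[of "n + N"] by (simp del: of_nat_Suc)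
      qed
      show "\<forall>n. a (n + N) - f (n + N) \<le> a (n + N)"
        using nonneg by simp
      have "(\<lambda>n. f (real (n + N))) \<longlonglongrightarrow> 0"
        using lim by (rule LIMSEQ_ignore_initial_segment)
      thus "(\<lambda>n. a (n + N) - f (n + N) - a (n + N)) \<longlonglongrightarrow> 0"
        using tendsto_minus by fastforce
    qed
    thus ?thesis using that by blast
  qed
  show ?thesis
  proof (intro exI allI impI)
    fix y :: real assume y: "y \<ge> N"
    define n where "n = nat \<lfloor>y\<rfloor>"
    have n: "n \<ge> N" "real n \<le> y" "y \<le> real n + 1"
      using y unfolding n_def by (linarith | simp add: le_nat_floor)+
    have "a n - f n \<le> c" "c \<le> a n" using c[of "n - N"] n by simp_all
    moreover have "0 \<le> F y - F n" "F y - F n \<le> f n"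
    proof -
      have "0 \<le> f y * (y - n)" using nonneg[of y] y n by simp
      thus "0 \<le> F y - F n" using mvt[of n y] n by simp
      have "f n * (y - n) \<le> f n * 1" using nonneg[of n] n by (intro mult_left_mono) auto
      thus "F y - F n \<le> f n" using mvt[of n y] n by simp
    qed
    moreover have "(\<Sum>k\<in>nats_upto y. f k) = a n + F n"
      by (simp add: a_def nats_upto_altdef n_def)
    ultimately show "\<bar>(\<Sum>k\<in>nats_upto y. f k) - F y - c\<bar> \<le> f (nat \<lfloor>y\<rfloor>)"
      unfolding n_def [symmetric] by linarith
  qed
qed

lemma half_le_floor:
  assumes "y \<ge> 1"
  shows "y / 2 \<le> real (nat \<lfloor>y\<rfloor>)"
proof -
  have "\<lfloor>y\<rfloor> \<ge> 1" using assms by simp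
  hence "real (nat \<lfloor>y\<rfloor>) = of_int \<lfloor>y\<rfloor>" "of_int \<lfloor>y\<rfloor> \<ge> (1::real)" by simp_all
  thus ?thesis by linarith
qed

lemma harmonic_asymptotics:
  "\<exists>c C. \<forall>y\<ge>1. \<bar>(\<Sum>k\<in>nats_upto y. 1 / real k) - ln y - c\<bar> \<le> C / y"
proof -
  have "\<exists>c. \<forall>y\<ge>real 1. \<bar>(\<Sum>k\<in>nats_upto y. 1 / real k) - ln y - c\<bar> \<le> 1 / real (nat \<lfloor>y\<rfloor>)"
    by (rule antimono_sum_asymptotics[where f = "\<lambda>t. 1 / t" and F = ln and N = 1])
       (auto intro!: derivative_eq_intros frac_le lim_inverse_n')
  then obtain c where c: "\<And>y. y \<ge> 1 \<Longrightarrow> \<bar>(\<Sum>k\<in>nats_upto y. 1 / real k) - ln y - c\<bar> \<le> 1 / real (nat \<lfloor>y\<rfloor>)"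
    by auto
  have "\<bar>(\<Sum>k\<in>nats_upto y. 1 / real k) - ln y - c\<bar> \<le> 2 / y" if "y \<ge> 1" for y
  proof -
    have "1 / real (nat \<lfloor>y\<rfloor>) \<le> 1 / (y / 2)"
      using half_le_floor[OF that] that by (intro divide_left_mono mult_pos_pos) auto
    thus ?thesis using c[OF that] by simp
  qed
  thus ?thesis by blast
qed

text \<open>
  The function \<open>ln t / t\<close> decreases only from \<open>exp 1\<close> on, so the range \<open>1 \<le> y < 3\<close> is absorbed
  into the constant.
\<close>

lemma sum_ln_over_asymptotics:
  "\<exists>c C. \<forall>y\<ge>1. \<bar>(\<Sum>k\<in>nats_upto y. ln (real k) / real k) - ln y ^ 2 / 2 - c\<bar> \<le> C * (1 + ln y) / y"
proof -
  have "\<exists>c. \<forall>y\<ge>real 3. \<bar>(\<Sum>k\<in>nats_upto y. ln (real k) / real k) - ln y ^ 2 / 2 - c\<bar>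
          \<le> ln (real (nat \<lfloor>y\<rfloor>)) / real (nat \<lfloor>y\<rfloor>)"
  proof (rule antimono_sum_asymptotics[where f = "\<lambda>t. ln t / t" and F = "\<lambda>t. ln t ^ 2 / 2" and N = 3])
    show "(\<lambda>n. ln (real n) / real n) \<longlonglongrightarrow> 0"
      by (rule filterlim_compose[OF ln_x_over_x_tendsto_0 filterlim_real_sequentially])
  qed (use exp_le in \<open>auto intro!: derivative_eq_intros ln_x_over_x_mono\<close>)
  then obtain c where c: "\<And>y. y \<ge> 3 \<Longrightarrow> \<bar>(\<Sum>k\<in>nats_upto y. ln (real k) / real k) - ln y ^ 2 / 2 - c\<bar>
      \<le> ln (real (nat \<lfloor>y\<rfloor>)) / real (nat \<lfloor>y\<rfloor>)"
    by auto
  define C where "C = 3 * (7 + \<bar>c\<bar>)"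
  have "\<bar>(\<Sum>k\<in>nats_upto y. ln (real k) / real k) - ln y ^ 2 / 2 - c\<bar> \<le> C * (1 + ln y) / y" 
    if y: "y \<ge> 1" for y
  proof (cases "y \<ge> 3")
    case True
    have "ln (real (nat \<lfloor>y\<rfloor>)) / real (nat \<lfloor>y\<rfloor>) \<le> ln y / (y / 2)"
      using half_le_floor[OF y] True by (intro frac_le) (auto intro!: ln_mono)
    also have "\<dots> \<le> C * (1 + ln y) / y"
    proof -
      have "2 * ln y \<le> C * (1 + ln y)" 
        unfolding C_def using True by (intro mult_mono) auto
      thus ?thesis using True by (simp add: divide_right_mono)
    qed
    finally show ?thesis by (rule order.trans[OF c[OF True]])
  next
    case False
    have l: "0 \<le> ln y" "ln y \<le> 2" using y False ln_le_minus_one[of y] by auto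
    have "ln y ^ 2 \<le> 2 ^ 2" using l by (intro power_mono)
    hence "ln y ^ 2 \<le> 4" by simp
    moreover have "0 \<le> ln y ^ 2" by simp
    moreover have "(\<Sum>k\<in>nats_upto y. ln (real k) / real k) \<le> (\<Sum>k\<in>nats_upto y. 1)"
    proof (rule sum_mono)
      fix k assume "k \<in> nats_upto y"
      hence "k > 0" by (simp add: nats_upto_def)
      thus "ln (real k) / real k \<le> 1" using ln_le_minus_one[of "real k"] by (simp add: field_simps)
    qed
    moreover have "(\<Sum>k\<in>nats_upto y. 1) \<le> (3::real)" using card_nats_upto_le[of y] y False by simp
    moreover have "(\<Sum>k\<in>nats_upto y. ln (real k) / real k) \<ge> 0"
      by (rule sum_nonneg) (auto simp: nats_upto_def)
    ultimately have "\<bar>(\<Sum>k\<in>nats_upto y. ln (real k) / real k) - ln y ^ 2 / 2 - c\<bar> \<le> 7 + \<bar>c\<bar>"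
      by linarith
    also have "\<dots> \<le> C * (1 + ln y) / y"
    proof -
      have "(7 + \<bar>c\<bar>) * y \<le> (7 + \<bar>c\<bar>) * 3" using False by (intro mult_left_mono) auto
      also have "\<dots> = C * 1" by (simp add: C_def)
      also have "\<dots> \<le> C * (1 + ln y)" using l by (intro mult_left_mono) (auto simp: C_def)
      finally show ?thesis using y by (simp add: field_simps)
    qed
    finally show ?thesis .
  qed
  thus ?thesis by blast
qed

definition mertens_sum :: "real \<Rightarrow> real" where
  "mertens_sum x = (\<Sum>n\<in>nats_upto x. \<Lambda> n / n)"

lemma sum_divisors_flip:
  fixes f :: "nat \<Rightarrow> real"
  assumes "m > 0"
  shows "(\<Sum>d | d dvd m. f (m div d)) = (\<Sum>d | d dvd m. f d)"
  by (rule sum.reindex_bij_witness[where i = "\<lambda>d. m div d" and j = "\<lambda>d. m div d"])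
     (use assms in \<open>auto elim!: dvdE\<close>)

text \<open>
  This is \<open>(\<Sum>d | d dvd k. \<Lambda> d) = ln k\<close>, summed over \<open>k \<le> y\<close> with weights \<open>1 / k\<close>.
\<close>

lemma sum_mertens_sum_over:
  "(\<Sum>n\<in>nats_upto y. mertens_sum (y / n) / n) = (\<Sum>k\<in>nats_upto y. ln (real k) / real k)"
proof -
  have "(\<Sum>n\<in>nats_upto y. mertens_sum (y / n) / n)
      = (\<Sum>n\<in>nats_upto y. \<Sum>m\<in>nats_upto (y / n). \<Lambda> m / real (n * m))"
    by (simp add: mertens_sum_def sum_divide_distrib mult.commute)
  also have "\<dots> = (\<Sum>k\<in>nats_upto y. \<Sum>n | n dvd k. \<Lambda> (k div n) / real (n * (k div n)))"
    by (rule sum_nats_upto_convolution)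
  also have "\<dots> = (\<Sum>k\<in>nats_upto y. ln (real k) / real k)"
  proof (intro sum.cong refl)
    fix k assume "k \<in> nats_upto y"
    hence k: "k > 0" by (simp add: nats_upto_def)
    have "(\<Sum>n | n dvd k. \<Lambda> (k div n) / real (n * (k div n))) = (\<Sum>n | n dvd k. \<Lambda> (k div n)) / k"
      unfolding sum_divide_distrib by (intro sum.cong refl) simp
    also have "\<dots> = ln (real k) / real k"
      using k by (simp add: sum_divisors_flip mangoldt_sum)
    finally show "(\<Sum>n | n dvd k. \<Lambda> (k div n) / real (n * (k div n))) = ln (real k) / real k" .
  qed
  finally show ?thesis .
qed

lemma one_plus_ln_squared_le:
  assumes "y \<ge> 1"
  shows "(1 + ln y) ^ 2 \<le> 25 * sqrt y"
proof -
  define z where "z = sqrt (sqrt y)"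
  have z: "z \<ge> 1" "z ^ 2 = sqrt y" using assms by (auto simp: z_def)
  have "z ^ 4 = (z ^ 2) ^ 2" by (simp flip: power_mult)
  with z(2) assms have z4: "y = z ^ 4" by simp
  have "ln y = 4 * ln z" unfolding z4 using z(1) by (subst ln_realpow) auto
  also have "ln z \<le> z - 1" using z(1) by (intro ln_le_minus_one) auto
  finally have "1 + ln y \<le> 5 * z" using z(1) by simp
  hence "(1 + ln y) ^ 2 \<le> (5 * z) ^ 2" using assms by (intro power_mono) auto
  thus ?thesis using z(2) by (simp add: power_mult_distrib)
qed

text \<open>
  Let \<open>E x = mertens_sum x - ln x + \<gamma>\<close> with Euler's constant \<open>\<gamma>\<close>. The choice of \<open>\<gamma>\<close> makes the
  logarithmic terms in \<open>T y = (\<Sum>n\<le>y. E (y / n) / n)\<close> cancel, and \<open>T y\<close> equals a constant \<open>\<kappa>\<close> up to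
  an error \<open>O((1 + ln y) / y)\<close>. Inverting this relation with weight 1 shows that \<open>E\<close> is bounded,
  which is Mertens' theorem. Inverting it with weight \<open>ln (x / d)\<close> gives Selberg's formula for \<open>E\<close>. The
  two contributions of \<open>\<kappa>\<close> are harmless because the sums of \<open>mobius d / d\<close> and of
  \<open>mobius d / d * ln (x / d)\<close> are bounded.
\<close>

lemma mertens_and_selberg:
  obtains \<gamma> A B where
    "\<And>x. x \<ge> 1 \<Longrightarrow> \<bar>mertens_sum x - ln x + \<gamma>\<bar> \<le> B"
    "\<And>x. x \<ge> 1 \<Longrightarrow> \<bar>(mertens_sum x - ln x + \<gamma>) * ln x
        + (\<Sum>m\<in>nats_upto x. \<Lambda> m / m * (mertens_sum (x / m) - ln (x / m) + \<gamma>))\<bar> \<le> A"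
proof -
  define H where "H y = (\<Sum>k\<in>nats_upto y. 1 / real k)" for y
  define S where "S y = (\<Sum>k\<in>nats_upto y. ln (real k) / real k)" for y
  obtain \<gamma> C1 where H: "\<And>y. y \<ge> 1 \<Longrightarrow> \<bar>H y - ln y - \<gamma>\<bar> \<le> C1 / y"
    using harmonic_asymptotics unfolding H_def by blast
  obtain c C2 where S: "\<And>y. y \<ge> 1 \<Longrightarrow> \<bar>S y - ln y ^ 2 / 2 - c\<bar> \<le> C2 * (1 + ln y) / y"
    using sum_ln_over_asymptotics unfolding S_def by blast
  have "C1 \<ge> 0" using H[of 1] by simp
  define E where "E x = mertens_sum x - ln x + \<gamma>" for x
  define T where "T y = (\<Sum>n\<in>nats_upto y. E (y / n) / n)" for y
  define \<kappa> where "\<kappa> = 2 * c + \<gamma> ^ 2"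
  define C where "C = 2 * C2 + (1 + \<bar>\<gamma>\<bar>) * C1"
  have T: "\<bar>T y - \<kappa>\<bar> \<le> C * (1 + ln y) / y" if y: "y \<ge> 1" for y
  proof -
    have "T y = (\<Sum>n\<in>nats_upto y. mertens_sum (y / n) / n + (ln (real n) / n - (ln y - \<gamma>) * (1 / n)))"
      unfolding T_def E_def
      by (intro sum.cong refl) (use y in \<open>auto simp: nats_upto_def ln_div field_simps\<close>)
    also have "\<dots> = 2 * S y - (ln y - \<gamma>) * H y"
      unfolding sum.distrib sum_mertens_sum_over sum_subtractf
      by (simp add: S_def H_def sum_distrib_left)
    finally have "T y - \<kappa> = 2 * (S y - ln y ^ 2 / 2 - c) - (ln y - \<gamma>) * (H y - ln y - \<gamma>)"
      by (simp add: \<kappa>_def algebra_simps power2_eq_square)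
    moreover have "\<bar>2 * a - b\<bar> \<le> 2 * \<bar>a\<bar> + \<bar>b\<bar>" for a b :: real by linarith
    ultimately have "\<bar>T y - \<kappa>\<bar> \<le> 2 * \<bar>S y - ln y ^ 2 / 2 - c\<bar> + \<bar>ln y - \<gamma>\<bar> * \<bar>H y - ln y - \<gamma>\<bar>"
      unfolding abs_mult [symmetric] by metis
    also have "\<dots> \<le> 2 * (C2 * (1 + ln y) / y) + (1 + \<bar>\<gamma>\<bar>) * (1 + ln y) * (C1 / y)"
    proof (intro add_mono mult_left_mono mult_mono S H y)
      have "\<bar>\<gamma>\<bar> * 1 \<le> \<bar>\<gamma>\<bar> * (1 + ln y)" using y by (intro mult_left_mono) auto
      moreover have "\<bar>ln y - \<gamma>\<bar> \<le> ln y + \<bar>\<gamma>\<bar>" using y ln_ge_zero[of y] by linarith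
      moreover have "(1 + \<bar>\<gamma>\<bar>) * (1 + ln y) = 1 + ln y + \<bar>\<gamma>\<bar> * (1 + ln y)" by (simp add: algebra_simps)
      ultimately show "\<bar>ln y - \<gamma>\<bar> \<le> (1 + \<bar>\<gamma>\<bar>) * (1 + ln y)" by linarith
    qed (use y in auto)
    also have "\<dots> = C * (1 + ln y) / y" 
      by (simp add: C_def algebra_simps add_divide_distrib)
    finally show ?thesis .
  qed
  have "C \<ge> 0" using T[of 1] by simp
  have T': "\<bar>(T y - \<kappa>) * w\<bar> \<le> 25 * C / sqrt y" if "y \<ge> 1" "\<bar>w\<bar> \<le> 1 + ln y" for y w
  proof -
    have "\<bar>(T y - \<kappa>) * w\<bar> \<le> (C * (1 + ln y) / y) * (1 + ln y)"
      unfolding abs_mult by (intro mult_mono T that) (use \<open>C \<ge> 0\<close> that in auto)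
    also have "\<dots> = C * (1 + ln y) ^ 2 / y" by (simp add: power2_eq_square)
    also have "\<dots> \<le> C * (25 * sqrt y) / y"
      using one_plus_ln_squared_le[OF that(1)] \<open>C \<ge> 0\<close> that
      by (intro divide_right_mono mult_left_mono) auto
    also have "\<dots> = 25 * C / sqrt y" using that by (simp add: field_simps)
    finally show ?thesis .
  qed
  have mu0: "\<bar>\<kappa> * (\<Sum>d\<in>nats_upto x. mobius d / d)\<bar> \<le> \<bar>\<kappa>\<bar> * 2" if "x \<ge> 1" for x
    unfolding abs_mult by (intro mult_left_mono abs_sum_mobius_over_le that) auto
  \<comment> \<open>Harmonic sums invert to 1, and they differ from \<open>ln + \<gamma>\<close> by an admissible error.\<close>
  have mu1: "\<bar>\<Sum>d\<in>nats_upto x. mobius d / d * ln (x / d)\<bar> \<le> 1 + 2 * C1 + 2 * \<bar>\<gamma>\<bar>" 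
    if x: "x \<ge> 1" for x
  proof -
    have "(\<Sum>d\<in>nats_upto x. mobius d / d * H (x / d)) = 1"
      unfolding H_def by (rule mobius_inversion[OF x])
    moreover have "(\<Sum>d\<in>nats_upto x. mobius d / d * H (x / d))
      = (\<Sum>d\<in>nats_upto x. mobius d / d * (H (x / d) - ln (x / d) - \<gamma>))
        + (\<Sum>d\<in>nats_upto x. mobius d / d * ln (x / d)) + \<gamma> * (\<Sum>d\<in>nats_upto x. mobius d / d)"
      by (simp add: sum.distrib [symmetric] sum_distrib_left algebra_simps)
    moreover have "\<bar>\<Sum>d\<in>nats_upto x. mobius d / d * (H (x / d) - ln (x / d) - \<gamma>)\<bar> \<le> 2 * C1"
    proof (rule mobius_sum_error_bound[OF _ x])
      fix y :: real assume y: "y \<ge> 1"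
      have "sqrt y * 1 \<le> sqrt y * sqrt y" using y by (intro mult_left_mono) auto
      hence "C1 / y \<le> C1 / sqrt y" using y \<open>C1 \<ge> 0\<close> by (intro divide_left_mono) auto
      thus "\<bar>H y - ln y - \<gamma>\<bar> \<le> C1 / sqrt y" using H[OF y] by linarith
    qed
    moreover have "\<bar>\<gamma> * (\<Sum>d\<in>nats_upto x. mobius d / d)\<bar> \<le> \<bar>\<gamma>\<bar> * 2"
      unfolding abs_mult by (intro mult_left_mono abs_sum_mobius_over_le x) auto
    ultimately show ?thesis by linarith
  qed
  show ?thesis
  proof
    fix x :: real assume x: "x \<ge> 1"
    have "E x = (\<Sum>d\<in>nats_upto x. mobius d / d * T (x / d))"
      unfolding T_def by (rule mobius_inversion[OF x, symmetric])
    also have "\<dots> = (\<Sum>d\<in>nats_upto x. mobius d / d * ((T (x / d) - \<kappa>) * 1)) 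
                   + \<kappa> * (\<Sum>d\<in>nats_upto x. mobius d / d)"
      by (simp add: sum.distrib [symmetric] sum_distrib_left algebra_simps)
    finally have eq: "E x = \<dots>" .
    have "\<bar>\<Sum>d\<in>nats_upto x. mobius d / d * ((T (x / d) - \<kappa>) * 1)\<bar> \<le> 2 * (25 * C)"
      by (rule mobius_sum_error_bound[OF T' x]) auto
    hence "\<bar>E x\<bar> \<le> 2 * (25 * C) + \<bar>\<kappa>\<bar> * 2" unfolding eq using mu0[OF x] by linarith
    thus "\<bar>mertens_sum x - ln x + \<gamma>\<bar> \<le> 2 * (25 * C) + \<bar>\<kappa>\<bar> * 2" unfolding E_def .
  next
    fix x :: real assume x: "x \<ge> 1"
    have "(\<Sum>d\<in>nats_upto x. mobius d / d * ln (x / d) * T (x / d))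
        = (\<Sum>m\<in>nats_upto x. E (x / m) / m * (\<Sum>d | d dvd m. mobius d * ln (x / d)))"
      unfolding T_def by (rule mobius_inversion_weighted)
    also have "\<dots> = (\<Sum>m\<in>nats_upto x. (if m = 1 then E x * ln x else 0) + \<Lambda> m / m * E (x / m))"
      by (intro sum.cong refl) (use x in \<open>auto simp: nats_upto_def sum_mobius_ln_divisors algebra_simps\<close>)
    also have "\<dots> = E x * ln x + (\<Sum>m\<in>nats_upto x. \<Lambda> m / m * E (x / m))"
      unfolding sum.distrib using x by (subst sum.delta) (simp_all, simp add: nats_upto_def)
    finally have 1: "E x * ln x + (\<Sum>m\<in>nats_upto x. \<Lambda> m / m * E (x / m))
        = (\<Sum>d\<in>nats_upto x. mobius d / d * ln (x / d) * T (x / d))" ..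
    also have "\<dots> = (\<Sum>d\<in>nats_upto x. mobius d / d * ((T (x / d) - \<kappa>) * ln (x / d)))
                  + \<kappa> * (\<Sum>d\<in>nats_upto x. mobius d / d * ln (x / d))"
      by (simp add: sum.distrib [symmetric] sum_distrib_left algebra_simps)
    finally have eq: "E x * ln x + (\<Sum>m\<in>nats_upto x. \<Lambda> m / m * E (x / m)) = \<dots>" .
    have "\<bar>\<Sum>d\<in>nats_upto x. mobius d / d * ((T (x / d) - \<kappa>) * ln (x / d))\<bar> \<le> 2 * (25 * C)"
      by (rule mobius_sum_error_bound[OF T' x]) auto
    moreover have "\<bar>\<kappa> * (\<Sum>d\<in>nats_upto x. mobius d / d * ln (x / d))\<bar> \<le> \<bar>\<kappa>\<bar> * (1 + 2 * C1 + 2 * \<bar>\<gamma>\<bar>)"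
      unfolding abs_mult by (intro mult_left_mono mu1 x) auto
    ultimately have "\<bar>E x * ln x + (\<Sum>m\<in>nats_upto x. \<Lambda> m / m * E (x / m))\<bar>
        \<le> 2 * (25 * C) + \<bar>\<kappa>\<bar> * (1 + 2 * C1 + 2 * \<bar>\<gamma>\<bar>)" unfolding eq by linarith
    thus "\<bar>(mertens_sum x - ln x + \<gamma>) * ln x
        + (\<Sum>m\<in>nats_upto x. \<Lambda> m / m * (mertens_sum (x / m) - ln (x / m) + \<gamma>))\<bar>
        \<le> 2 * (25 * C) + \<bar>\<kappa>\<bar> * (1 + 2 * C1 + 2 * \<bar>\<gamma>\<bar>)" unfolding E_def .
  qed
qed

section \<open>The prime mass of multiplicative windows\<close>

text \<open>
  The quantity \<open>\<Lambda> n / n\<close> is regarded as a mass at the point \<open>ln n\<close>. Mertens' theorem says that the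
  mass of a long interval on this logarithmic scale is its length up to a bounded error, and
  \<open>window_mass s x\<close> is the mass of the interval of length \<open>s\<close> that starts at \<open>ln x\<close>.
\<close>

definition window_mass :: "real \<Rightarrow> real \<Rightarrow> real" where
  "window_mass s x = mertens_sum (exp s * x) - mertens_sum x"

lemma sum_nats_upto_diff:
  fixes f :: "nat \<Rightarrow> real"
  assumes "x \<le> y"
  shows "(\<Sum>n\<in>nats_upto y. f n) = (\<Sum>n\<in>nats_upto x. f n) + (\<Sum>n\<in>nats_upto y - nats_upto x. f n)"
  using sum.subset_diff[OF nats_upto_mono[OF assms] finite_nats_upto, of f] by simp

lemma mertens_sum_diff:
  assumes "x \<le> y"
  shows "mertens_sum y - mertens_sum x = (\<Sum>n\<in>nats_upto y - nats_upto x. \<Lambda> n / n)"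
  unfolding mertens_sum_def using sum_nats_upto_diff[OF assms, of "\<lambda>n. \<Lambda> n / n"] by simp

lemma mertens_sum_mono: "x \<le> y \<Longrightarrow> mertens_sum x \<le> mertens_sum y"
  unfolding mertens_sum_def by (intro sum_mono2 nats_upto_mono) (auto simp: mangoldt_nonneg)

lemma window_mass_nonneg: "s \<ge> 0 \<Longrightarrow> x \<ge> 0 \<Longrightarrow> window_mass s x \<ge> 0"
  using mertens_sum_mono[of x "exp s * x"] mult_right_mono[of 1 "exp s" x]
  by (simp add: window_mass_def)

lemma window_mass_mono: "s \<le> t \<Longrightarrow> x \<ge> 0 \<Longrightarrow> window_mass s x \<le> window_mass t x"
  using mertens_sum_mono[of "exp s * x" "exp t * x"] by (simp add: window_mass_def mult_right_mono)

lemma window_mass_add: "window_mass (s + t) x = window_mass s x + window_mass t (exp s * x)"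
  by (simp add: window_mass_def exp_add mult_ac)

lemma mertens:
  obtains B where "B \<ge> 0" "\<And>x. x \<ge> 1 \<Longrightarrow> \<bar>mertens_sum x - ln x\<bar> \<le> B"
proof (rule mertens_and_selberg)
  fix \<gamma> A B
  assume B: "\<And>x. x \<ge> 1 \<Longrightarrow> \<bar>mertens_sum x - ln x + \<gamma>\<bar> \<le> B"
  have "B \<ge> 0" using B[of 1] by simp
  show thesis
  proof (rule that)
    show "B + \<bar>\<gamma>\<bar> \<ge> 0" using \<open>B \<ge> 0\<close> by simp
    show "\<bar>mertens_sum x - ln x\<bar> \<le> B + \<bar>\<gamma>\<bar>" if "x \<ge> 1" for x
      using B[OF that] by linarith
  qed
qed

text \<open>
  Selberg's formula at \<open>exp s * x\<close> minus the same formula at \<open>x\<close>. The range \<open>x < m \<le> exp s * x\<close>,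
  present in only one of the two sums, has bounded mass. The error is uniform in \<open>s \<le> M\<close>, so
  \<open>window_mass_upper\<close> applies to windows of varying length.
\<close>

lemma selberg_window:
  assumes "M \<ge> 0"
  obtains A where "\<And>x s. x \<ge> 1 \<Longrightarrow> 0 \<le> s \<Longrightarrow> s \<le> M \<Longrightarrow>
    \<bar>window_mass s x * ln x + (\<Sum>m\<in>nats_upto x. \<Lambda> m / m * window_mass s (x / m)) - 2 * s * ln x\<bar> \<le> A"
proof (rule mertens_and_selberg)
  fix \<gamma> A B
  define E where "E x = mertens_sum x - ln x + \<gamma>" for x
  define S where "S x = E x * ln x + (\<Sum>m\<in>nats_upto x. \<Lambda> m / m * E (x / m))" for x
  assume "\<And>x. x \<ge> 1 \<Longrightarrow> \<bar>mertens_sum x - ln x + \<gamma>\<bar> \<le> B"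
  hence B: "\<bar>E x\<bar> \<le> B" if "x \<ge> 1" for x using that unfolding E_def by blast
  assume "\<And>x. x \<ge> 1 \<Longrightarrow> \<bar>(mertens_sum x - ln x + \<gamma>) * ln x
        + (\<Sum>m\<in>nats_upto x. \<Lambda> m / m * (mertens_sum (x / m) - ln (x / m) + \<gamma>))\<bar> \<le> A"
  hence A: "\<bar>S x\<bar> \<le> A" if "x \<ge> 1" for x using that unfolding S_def E_def by blast
  have "B \<ge> 0" using B[of 1] by simp
  have E_diff: "E (exp s * y) = E y + window_mass s y - s" if "y > 0" for s y
    using that by (simp add: E_def window_mass_def ln_mult)
  show thesis
  proof (rule that)
    fix x s :: real
    assume x: "x \<ge> 1" and s: "0 \<le> s" "s \<le> M"
    define x' where "x' = exp s * x"
    have "x' \<ge> x" using x s mult_right_mono[of 1 "exp s" x] by (simp add: x'_def)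
    moreover have "ln x' = ln x + s" using x by (simp add: x'_def ln_mult)
    ultimately have x': "x' \<ge> x" "x' \<ge> 1" "ln x' = ln x + s" using x by auto
    define R where "R = (\<Sum>m\<in>nats_upto x' - nats_upto x. \<Lambda> m / m * E (x' / m))"
    define V where "V = (\<Sum>m\<in>nats_upto x. \<Lambda> m / m * window_mass s (x / m))"
    have "(\<Sum>m\<in>nats_upto x. \<Lambda> m / m * E (x' / m))
        = (\<Sum>m\<in>nats_upto x. \<Lambda> m / m * E (x / m) + \<Lambda> m / m * window_mass s (x / m) - s * (\<Lambda> m / m))"
    proof (intro sum.cong refl)
      fix m assume "m \<in> nats_upto x"
      hence "x / m > 0" using x by (simp add: nats_upto_def)
      from E_diff[OF this, of s] have eq: "E (x' / m) = E (x / m) + window_mass s (x / m) - s"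
        by (simp add: x'_def)
      show "\<Lambda> m / m * E (x' / m) = \<Lambda> m / m * E (x / m) + \<Lambda> m / m * window_mass s (x / m) - s * (\<Lambda> m / m)"
        unfolding eq by (simp only: ring_distribs mult.commute)
    qed
    also have "\<dots> = (S x - E x * ln x) + V - s * mertens_sum x"
      by (simp add: sum.distrib sum_subtractf S_def V_def mertens_sum_def sum_distrib_left)
    finally have "S x' = E x' * ln x' + ((S x - E x * ln x) + V - s * mertens_sum x) + R"
      unfolding S_def[of x'] R_def using sum_nats_upto_diff[OF x'(1), of "\<lambda>m. \<Lambda> m / m * E (x' / m)"]
      by simp
    moreover have E': "E x' = E x + window_mass s x - s" unfolding x'_def using E_diff x by simp
    moreover have "E x' * ln x' = (E x + window_mass s x - s) * ln x + s * E x'"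
      unfolding x'(3) E' [symmetric] by (simp add: algebra_simps)
    moreover have "s * mertens_sum x = s * ln x + s * (E x - \<gamma>)"
      by (simp add: E_def algebra_simps)
    ultimately have eq: "window_mass s x * ln x + V - 2 * s * ln x
        = S x' - S x + s * (E x - \<gamma>) - s * E x' - R"
      by (simp only: ring_distribs)
    have "\<bar>R\<bar> \<le> (\<Sum>m\<in>nats_upto x' - nats_upto x. \<Lambda> m / m * B)"
      unfolding R_def
    proof (rule order.trans[OF sum_abs], intro sum_mono)
      fix m assume m: "m \<in> nats_upto x' - nats_upto x"
      hence "x' / m \<ge> 1" by (auto simp: nats_upto_def)
      from B[OF this] show "\<bar>\<Lambda> m / m * E (x' / m)\<bar> \<le> \<Lambda> m / m * B"
        unfolding abs_mult by (intro mult_mono) (auto simp: mangoldt_nonneg)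
    qed
    also have "\<dots> = window_mass s x * B"
      unfolding window_mass_def x'_def[symmetric] mertens_sum_diff[OF x'(1)] by (simp add: sum_distrib_right)
    also have "\<dots> \<le> (M + 2 * B) * B"
    proof (intro mult_right_mono)
      show "window_mass s x \<le> M + 2 * B"
        using E' B[OF x] B[OF x'(2)] s by linarith
    qed fact
    finally have R: "\<bar>R\<bar> \<le> (M + 2 * B) * B" .
    have "\<bar>s * (E x - \<gamma>)\<bar> \<le> M * (B + \<bar>\<gamma>\<bar>)" "\<bar>s * E x'\<bar> \<le> M * B"
      unfolding abs_mult using B[OF x] B[OF x'(2)] s assms by (intro mult_mono; linarith)+
    with R A[OF x] A[OF x'(2)] show "\<bar>window_mass s x * ln x 
          + (\<Sum>m\<in>nats_upto x. \<Lambda> m / m * window_mass s (x / m)) - 2 * s * ln x\<bar>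
        \<le> 2 * A + M * (B + \<bar>\<gamma>\<bar>) + M * B + (M + 2 * B) * B"
      unfolding V_def[symmetric] eq by linarith
  qed
qed

text \<open>
  The sum in \<open>selberg_window\<close> is nonnegative, so the local density of the mass is asymptotically
  at most 2, twice its average.
\<close>

lemma window_mass_upper:
  assumes "M \<ge> 0" "\<sigma> > 0"
  obtains Y where "Y \<ge> 1" "\<And>y s. y \<ge> Y \<Longrightarrow> 0 \<le> s \<Longrightarrow> s \<le> M \<Longrightarrow> window_mass s y \<le> 2 * s + \<sigma>"
proof (rule selberg_window[OF assms(1)])
  fix A assume A: "\<And>x s. x \<ge> 1 \<Longrightarrow> 0 \<le> s \<Longrightarrow> s \<le> M \<Longrightarrow>
    \<bar>window_mass s x * ln x + (\<Sum>m\<in>nats_upto x. \<Lambda> m / m * window_mass s (x / m)) - 2 * s * ln x\<bar> \<le> A"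
  define Y where "Y = exp (max 1 (A / \<sigma>))"
  show thesis
  proof (rule that)
    show "Y \<ge> 1" by (simp add: Y_def)
    fix y s assume y: "y \<ge> Y" and s: "0 \<le> s" "s \<le> M"
    have "y > 0" using y by (auto simp: Y_def intro: less_le_trans[OF exp_gt_zero])
    with y have "max 1 (A / \<sigma>) \<le> ln y" unfolding Y_def by (subst ln_ge_iff)
    hence ln: "ln y \<ge> 1" "A / \<sigma> \<le> ln y" by simp_all
    have "y \<ge> 1" using y \<open>Y \<ge> 1\<close> by simp
    have "(\<Sum>m\<in>nats_upto y. \<Lambda> m / m * window_mass s (y / m)) \<ge> 0"
      using s \<open>y > 0\<close> by (intro sum_nonneg mult_nonneg_nonneg window_mass_nonneg) (auto simp: mangoldt_nonneg)
    hence "window_mass s y * ln y \<le> 2 * s * ln y + A"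
      using A[OF \<open>y \<ge> 1\<close> s] by linarith
    also have "A \<le> \<sigma> * ln y" using ln assms by (simp add: field_simps)
    finally have "window_mass s y * ln y \<le> (2 * s + \<sigma>) * ln y" by (simp add: algebra_simps)
    thus "window_mass s y \<le> 2 * s + \<sigma>" using ln by simp
  qed
qed

text \<open>
  If the window at \<open>x\<close> has almost no mass, then Selberg's formula forces the windows at \<open>x / n\<close> to
  have almost maximal mass \<open>2 * u\<close>, on average over \<open>n\<close> with weights \<open>\<Lambda> n / n\<close>. Since \<open>ln x\<close> may be
  arbitrarily large, the pigeonhole principle provides a logarithmic interval of any
  prescribed length \<open>T\<close>, starting at \<open>ln w\<close>, on which the total deficit is as small as desired.
  The summand \<open>\<eta>\<close> makes all deficits in this interval nonnegative.
\<close>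

lemma small_deficit_window:
  assumes "u \<ge> 0" and light: "\<And>\<eta> X. \<eta> > 0 \<Longrightarrow> \<exists>x\<ge>X. window_mass u x < \<eta>"
    and "s > 0" "T > 0" "X \<ge> 1" "Y \<ge> 1"
  obtains x w \<eta> where "w \<ge> X" "exp T * w * Y \<le> x" "\<eta> > 0"
    "\<And>n. n \<in> nats_upto (exp T * w) \<Longrightarrow> window_mass u (x / n) \<le> 2 * u + \<eta>"
    "(\<Sum>n\<in>nats_upto (exp T * w) - nats_upto w. \<Lambda> n / n * (2 * u - window_mass u (x / n) + \<eta>)) < s"
proof -
  obtain B where B: "B \<ge> 0" "\<And>x. x \<ge> 1 \<Longrightarrow> \<bar>mertens_sum x - ln x\<bar> \<le> B" by (rule mertens) blast
  obtain A where A: "\<And>x s. x \<ge> 1 \<Longrightarrow> 0 \<le> s \<Longrightarrow> s \<le> u \<Longrightarrow>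
    \<bar>window_mass s x * ln x + (\<Sum>m\<in>nats_upto x. \<Lambda> m / m * window_mass s (x / m)) - 2 * s * ln x\<bar> \<le> A"
    using selberg_window[OF assms(1)] by metis
  \<comment> \<open>Up to bounded terms the deficits sum to at most \<open>2 * \<eta> * ln x\<close>, while about \<open>ln x / T\<close> intervals with deficit at
    least \<open>s\<close> would give \<open>4 * \<eta> * ln x\<close>.\<close>
  define \<eta> where "\<eta> = s / (4 * T)"
  have "\<eta> > 0" using assms by (simp add: \<eta>_def)
  obtain Y1 where Y1: "Y1 \<ge> 1" "\<And>y. y \<ge> Y1 \<Longrightarrow> window_mass u y \<le> 2 * u + \<eta>"
    using window_mass_upper[OF \<open>u \<ge> 0\<close> \<open>\<eta> > 0\<close>] \<open>u \<ge> 0\<close> by (metis order.refl)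
  \<comment> \<open>Only \<open>n \<le> x / Z\<close> are used, for which \<open>x / n\<close> is large enough for the density bound.\<close>
  define Z where "Z = max Y Y1"
  have Z: "Z \<ge> 1" "Z \<ge> Y" "Z \<ge> Y1" using Y1 by (auto simp: Z_def)
  define C where "C = (2 * u + \<eta>) * B + A + 2 * B * (ln Z + 2 * B)"
  define D where "D = C + s * (ln Z + ln X) / T + s"
  obtain x where x: "x \<ge> max (X * Z) (exp (2 * T * D / s + 1))" "window_mass u x < \<eta>"
    using light[OF \<open>\<eta> > 0\<close>] by blast
  have XZ: "X * Z \<ge> 1" using mult_mono[of 1 X 1 Z] assms Z by simp
  have x1: "x \<ge> 1" "X * Z \<le> x" using x XZ by auto
  have lnx: "ln x > 2 * T * D / s" using x x1 ln_ge_iff[of x "2 * T * D / s + 1"] by simp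
  have "x / Z \<le> x" using x1 Z by (simp add: field_simps)
  have "x / Z \<ge> X" using x1 Z by (simp add: field_simps)
  define g where "g n = \<Lambda> n / n * (2 * u - window_mass u (x / n) + \<eta>)" for n :: nat
  define P where "P z = (\<Sum>n\<in>nats_upto z. g n)" for z
  have upper: "window_mass u (x / n) \<le> 2 * u + \<eta>" if "n \<in> nats_upto (x / Z)" for n
  proof (rule Y1(2))
    have "Z \<le> x / n" using that Z by (auto simp: nats_upto_def field_simps)
    thus "Y1 \<le> x / n" using Z by linarith
  qed
  have g_nonneg: "g n \<ge> 0" if "n \<in> nats_upto (x / Z)" for n
    unfolding g_def using upper[OF that] by (intro mult_nonneg_nonneg) (auto simp: mangoldt_nonneg)
  have "P x \<le> 2 * \<eta> * ln x + (2 * u + \<eta>) * B + A"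
  proof -
    have "P x = (2 * u + \<eta>) * mertens_sum x - (\<Sum>m\<in>nats_upto x. \<Lambda> m / m * window_mass u (x / m))"
      unfolding P_def g_def mertens_sum_def sum_distrib_left sum_subtractf [symmetric]
      by (intro sum.cong refl) (simp only: ring_distribs mult.commute)
    moreover have "(\<Sum>m\<in>nats_upto x. \<Lambda> m / m * window_mass u (x / m)) \<ge> 2 * u * ln x - window_mass u x * ln x - A"
      using A[OF x1(1) \<open>u \<ge> 0\<close> order.refl] by linarith
    moreover have "window_mass u x * ln x \<le> \<eta> * ln x"
      using x x1 by (intro mult_right_mono) auto
    moreover have "(2 * u + \<eta>) * mertens_sum x \<le> (2 * u + \<eta>) * (ln x + B)"
      using B(2)[OF x1(1)] \<open>u \<ge> 0\<close> \<open>\<eta> > 0\<close> by (intro mult_left_mono) auto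
    ultimately show ?thesis by (simp add: algebra_simps)
  qed
  \<comment> \<open>Deficits may be negative for \<open>n\<close> between \<open>x / Z\<close> and \<open>x\<close>, but the mass of this range is bounded.\<close>
  moreover have "P x \<ge> P (x / Z) - 2 * B * (ln Z + 2 * B)"
  proof -
    have "P x - P (x / Z) = (\<Sum>n\<in>nats_upto x - nats_upto (x / Z). g n)"
      unfolding P_def using sum_nats_upto_diff[OF \<open>x / Z \<le> x\<close>, of g] by simp
    moreover have "(\<Sum>n\<in>nats_upto x - nats_upto (x / Z). \<Lambda> n / n * (- (2 * B)))
        \<le> (\<Sum>n\<in>nats_upto x - nats_upto (x / Z). g n)"
    proof (intro sum_mono)
      fix n assume "n \<in> nats_upto x - nats_upto (x / Z)"
      hence n: "x / n \<ge> 1" by (auto simp: nats_upto_def)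
      have "exp u * (x / n) \<ge> 1" using n \<open>u \<ge> 0\<close> mult_mono[of 1 "exp u" 1 "x / n"] by simp
      from B(2)[OF this] B(2)[OF n] have "window_mass u (x / n) \<le> ln (exp u * (x / n)) - ln (x / n) + 2 * B"
        unfolding window_mass_def by linarith
      also have "ln (exp u * (x / n)) = u + ln (x / n)" using n by (subst ln_mult) auto
      finally have "window_mass u (x / n) \<le> u + 2 * B" by simp
      hence "- (2 * B) \<le> 2 * u - window_mass u (x / n) + \<eta>" using \<open>u \<ge> 0\<close> \<open>\<eta> > 0\<close> by linarith
      thus "\<Lambda> n / n * (- (2 * B)) \<le> g n"
        unfolding g_def by (intro mult_left_mono) (auto simp: mangoldt_nonneg)
    qed
    moreover have "(\<Sum>n\<in>nats_upto x - nats_upto (x / Z). \<Lambda> n / n * (- (2 * B)))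
        = - (2 * B) * (mertens_sum x - mertens_sum (x / Z))"
      unfolding mertens_sum_diff[OF \<open>x / Z \<le> x\<close>] sum_distrib_left by (simp add: mult.commute)
    moreover have "- (2 * B) * (mertens_sum x - mertens_sum (x / Z)) \<ge> - (2 * B) * (ln Z + 2 * B)"
    proof (intro mult_left_mono_neg)
      have "x / Z \<ge> 1" using \<open>x / Z \<ge> X\<close> \<open>X \<ge> 1\<close> by linarith
      from B(2)[OF this] B(2)[OF x1(1)] show "mertens_sum x - mertens_sum (x / Z) \<le> ln Z + 2 * B"
        using x1 Z by (simp add: ln_div)
    qed (use B in auto)
    ultimately show ?thesis by simp
  qed
  ultimately have PZ: "P (x / Z) \<le> 2 * \<eta> * ln x + C" unfolding C_def by linarith
  define J where "J = nat \<lfloor>(ln x - ln Z - ln X) / T\<rfloor>"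
  have ln_ge: "ln x - ln Z - ln X \<ge> 0"
  proof -
    have "ln (X * Z) \<le> ln x" using x1 XZ by (intro ln_mono) auto
    thus ?thesis using assms Z by (simp add: ln_mult)
  qed
  hence J: "J \<le> (ln x - ln Z - ln X) / T" "(ln x - ln Z - ln X) / T \<le> J + 1"
    using \<open>T > 0\<close> unfolding J_def by (auto intro!: of_nat_floor) linarith
  define v where "v j = exp (j * T) * X" for j :: nat
  have v_Suc: "v (Suc j) = exp T * v j" for j by (simp add: v_def exp_add ring_distribs)
  have v_ge: "v j \<ge> X" for j using assms mult_right_mono[of 1 "exp (j * T)" X] by (simp add: v_def)
  have v_mono: "v i \<le> v j" if "i \<le> j" for i j
    using that assms by (auto simp: v_def intro!: mult_right_mono)
  have vJ: "v J \<le> x / Z"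
  proof -
    have "exp (J * T) * X \<le> exp (ln x - ln Z - ln X) * X"
      using J(1) assms by (intro mult_right_mono) (auto simp: field_simps)
    also have "\<dots> = x / Z" using x1 Z assms by (simp add: exp_diff)
    finally show ?thesis by (simp add: v_def)
  qed
  have "\<exists>j<J. P (v (Suc j)) - P (v j) < s"
  proof (rule ccontr)
    assume "\<not> (\<exists>j<J. P (v (Suc j)) - P (v j) < s)"
    hence "(\<Sum>j<J. P (v (Suc j)) - P (v j)) \<ge> (\<Sum>j<J. s)"
      by (intro sum_mono) auto
    hence "J * s \<le> P (v J) - P (v 0)" 
      using sum_lessThan_telescope[of "\<lambda>j. P (v j)" J] by simp
    moreover have "P (v J) \<le> P (x / Z)"
      unfolding P_def by (intro sum_mono2 nats_upto_mono vJ) (use g_nonneg in auto)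
    moreover have "P (v 0) \<ge> 0"
      unfolding P_def
    proof (intro sum_nonneg g_nonneg)
      fix n assume "n \<in> nats_upto (v 0)"
      thus "n \<in> nats_upto (x / Z)" using nats_upto_mono[of "v 0" "x / Z"] v_mono[of 0 J] vJ by auto
    qed
    ultimately have "J * s \<le> 2 * \<eta> * ln x + C" using PZ by linarith
    moreover have "(ln x - ln Z - ln X) / T * s \<le> (J + 1) * s"
      using J(2) \<open>s > 0\<close> by (intro mult_right_mono) auto
    ultimately have "(ln x - ln Z - ln X) / T * s \<le> s / (2 * T) * ln x + C + s"
      by (simp add: \<eta>_def algebra_simps)
    moreover have "(ln x - ln Z - ln X) / T * s = 2 * (s / (2 * T) * ln x) - s * (ln Z + ln X) / T"
      using \<open>T > 0\<close> by (simp add: field_simps)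
    ultimately have "s / (2 * T) * ln x \<le> D" unfolding D_def by linarith
    hence "ln x \<le> 2 * T * D / s" using \<open>T > 0\<close> \<open>s > 0\<close> by (simp add: field_simps)
    with lnx show False by simp
  qed
  then obtain j where j: "j < J" "P (v (Suc j)) - P (v j) < s" by blast
  have le: "exp T * v j \<le> x / Z" using v_mono[of "Suc j" J] vJ j unfolding v_Suc[symmetric] by auto
  show ?thesis
  proof (rule that[of "v j" x \<eta>])
    show "v j \<ge> X" by (rule v_ge)
    have "exp T * v j * Y \<le> exp T * v j * Z" using Z v_ge[of j] assms by (intro mult_left_mono) auto
    also have "\<dots> \<le> x" using le Z by (simp add: field_simps)
    finally show "exp T * v j * Y \<le> x" .
    show "window_mass u (x / n) \<le> 2 * u + \<eta>" if "n \<in> nats_upto (exp T * v j)" for n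
      using that nats_upto_mono[OF le] by (intro upper) auto
    have "v j \<le> exp T * v j" unfolding v_Suc[symmetric] by (rule v_mono) simp
    from sum_nats_upto_diff[OF this, of g] j(2)
    show "(\<Sum>n\<in>nats_upto (exp T * v j) - nats_upto (v j). \<Lambda> n / n * (2 * u - window_mass u (x / n) + \<eta>)) < s"
      unfolding v_Suc P_def g_def by simp
  qed fact
qed

text \<open>
  This is Erdos's argument. Suppose that windows of length \<open>l\<close> have mass bounded below while windows
  of length \<open>u = 3 / 4 * l\<close> can be almost empty. Take \<open>x\<close> and a long interval as in
  \<open>small_deficit_window\<close>, and call \<open>n\<close> in this interval good if the window of length \<open>u\<close> at \<open>x / n\<close>
  has nearly the maximal mass \<open>2 * u\<close>. The bad \<open>n\<close> have less mass than any window of length \<open>l\<close>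
  contains, so every such window contains a good \<open>n\<close>. Hence there is a chain of good \<open>n\<close> whose
  logarithms advance by at most \<open>l\<close>, and the windows at the points \<open>x / n\<close> cover at least three
  quarters of the distance traversed with density nearly 2. The mean density along the chain is
  thus nearly \<open>3 / 2\<close>, whereas by Mertens it tends to 1 for long chains.
\<close>

lemma window_mass_shrink:
  assumes "l > 0" "\<delta> > 0" and heavy: "\<And>x. x \<ge> X0 \<Longrightarrow> window_mass l x \<ge> \<delta>"
  shows "\<exists>\<delta>'>0. \<exists>X. \<forall>x\<ge>X. window_mass (3 / 4 * l) x \<ge> \<delta>'"
proof (rule ccontr)
  define u where "u = 3 / 4 * l"
  define \<sigma> where "\<sigma> = l / 16"
  assume "\<not> ?thesis"
  hence light: "\<exists>x\<ge>X. window_mass u x < \<eta>" if "\<eta> > 0" for \<eta> X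
    using that unfolding u_def by (meson not_le)
  have "u \<ge> 0" "\<sigma> > 0" using \<open>l > 0\<close> by (simp_all add: u_def \<sigma>_def)
  obtain B where B: "B \<ge> 0" "\<And>x. x \<ge> 1 \<Longrightarrow> \<bar>mertens_sum x - ln x\<bar> \<le> B" by (rule mertens) blast
  obtain Y where Y: "Y \<ge> 1" "\<And>y s. y \<ge> Y \<Longrightarrow> 0 \<le> s \<Longrightarrow> s \<le> l \<Longrightarrow> window_mass s y \<le> 2 * s + \<sigma>"
    using window_mass_upper[of l \<sigma>] \<open>l > 0\<close> \<open>\<sigma> > 0\<close> by (metis less_imp_le)
  \<comment> \<open>Each pair of steps along the chain gains at least \<open>l / 4\<close> over the mass expected on average, so
    \<open>k\<close> pairs exceed the error in Mertens' theorem.\<close>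
  obtain k :: nat where k: "k * l / 4 > 2 * B"
  proof -
    have "l / 4 > 0" using \<open>l > 0\<close> by simp
    then obtain k :: nat where "2 * B < k * (l / 4)" using reals_Archimedean3 by blast
    thus thesis by (intro that[of k]) simp
  qed
  define T where "T = (2 * k + 1) * l"
  obtain x w \<eta> where w: "w \<ge> max 1 X0" and x: "exp T * w * Y \<le> x" and "\<eta> > 0"
    and upper: "\<And>n. n \<in> nats_upto (exp T * w) \<Longrightarrow> window_mass u (x / n) \<le> 2 * u + \<eta>"
    and small: "(\<Sum>n\<in>nats_upto (exp T * w) - nats_upto w. \<Lambda> n / n * (2 * u - window_mass u (x / n) + \<eta>)) < \<delta> * \<sigma>"
    by (rule small_deficit_window[OF \<open>u \<ge> 0\<close> light, of "\<delta> * \<sigma>" T "max 1 X0" Y])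
       (use \<open>l > 0\<close> \<open>\<delta> > 0\<close> \<open>\<sigma> > 0\<close> Y in \<open>auto simp: T_def\<close>)
  have "w \<ge> 1" using w by simp
  define good where "good n \<longleftrightarrow> w < real n \<and> real n \<le> exp T * w \<and> window_mass u (x / n) \<ge> 2 * u - \<sigma>" for n :: nat
  have good_pos: "real n > 0" if "good n" for n using that \<open>w \<ge> 1\<close> by (auto simp: good_def)
  have ge_Y: "x / n \<ge> Y" if "good n" for n
  proof -
    have "real n * Y \<le> exp T * w * Y" using that Y by (intro mult_right_mono) (auto simp: good_def)
    thus ?thesis using x good_pos[OF that] by (simp add: field_simps)
  qed
  have ex_good: "\<exists>n. good n \<and> y < n \<and> n \<le> exp l * y" if y: "w \<le> y" "exp l * y \<le> exp T * w" for y
  proof (rule ccontr)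
    assume none: "\<not> ?thesis"
    have sub: "nats_upto (exp l * y) - nats_upto y \<subseteq> nats_upto (exp T * w) - nats_upto w"
      using y by (auto simp: nats_upto_def)
    have "y \<ge> 0" using y \<open>w \<ge> 1\<close> by simp
    hence "y \<le> exp l * y" using \<open>l > 0\<close> mult_right_mono[of 1 "exp l" y] by simp
    have "\<delta> * \<sigma> \<le> window_mass l y * \<sigma>"
      using heavy[of y] y w \<open>\<sigma> > 0\<close> by (intro mult_right_mono) auto
    also have "\<dots> = (\<Sum>n\<in>nats_upto (exp l * y) - nats_upto y. \<Lambda> n / n * \<sigma>)"
      unfolding window_mass_def mertens_sum_diff[OF \<open>y \<le> exp l * y\<close>] sum_distrib_right ..
    also have "\<dots> \<le> (\<Sum>n\<in>nats_upto (exp l * y) - nats_upto y. \<Lambda> n / n * (2 * u - window_mass u (x / n) + \<eta>))"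
    proof (intro sum_mono mult_left_mono)
      fix n assume n: "n \<in> nats_upto (exp l * y) - nats_upto y"
      hence "y < n" "n \<le> exp l * y" by (auto simp: nats_upto_def)
      with none have "\<not> good n" by blast
      moreover have "n \<in> nats_upto (exp T * w) - nats_upto w" using n sub by blast
      hence "w < n" "n \<le> exp T * w" by (auto simp: nats_upto_def)
      ultimately have "window_mass u (x / n) < 2 * u - \<sigma>" by (simp add: good_def)
      thus "\<sigma> \<le> 2 * u - window_mass u (x / n) + \<eta>" using \<open>\<eta> > 0\<close> by simp
    qed (auto simp: mangoldt_nonneg)
    also have "\<dots> \<le> (\<Sum>n\<in>nats_upto (exp T * w) - nats_upto w. \<Lambda> n / n * (2 * u - window_mass u (x / n) + \<eta>))"
    proof (intro sum_mono2 sub mult_nonneg_nonneg)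
      fix n assume "n \<in> nats_upto (exp T * w) - nats_upto w - (nats_upto (exp l * y) - nats_upto y)"
      thus "0 \<le> 2 * u - window_mass u (x / n) + \<eta>" using upper[of n] by simp
    qed (auto simp: mangoldt_nonneg)
    finally show False using small by simp
  qed
  have step: "mertens_sum (x / n) - mertens_sum (x / m) \<ge> 3 / 2 * ln (m / n) - 2 * \<sigma>"
    if "good n" "good m" "n \<le> m" "m \<le> exp l * n" for m n :: nat
  proof -
    define y where "y = x / m"
    define t where "t = ln (m / n)"
    have pos: "real n > 0" "real m > 0" using that good_pos by auto
    have "m / n \<le> exp l" using that pos by (simp add: field_simps)
    hence "ln (m / n) \<le> ln (exp l)" using pos by (intro ln_mono) auto
    hence t: "0 \<le> t" "t \<le> l" using pos that(3) by (auto simp: t_def)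
    have eq: "x / n = exp t * y" using pos by (simp add: t_def y_def)
    have "y \<ge> Y" unfolding y_def by (rule ge_Y) fact
    hence "y \<ge> 1" using Y by simp
    have lower: "window_mass u y \<ge> 2 * u - \<sigma>" using that by (simp add: good_def y_def)
    have "window_mass t y \<ge> 3 / 2 * t - 2 * \<sigma>"
    \<comment> \<open>For \<open>t < u\<close> the window at \<open>y\<close> overshoots \<open>x / n\<close>; the part beyond has density at most 2, so the
      part before \<open>x / n\<close> is still nearly full.\<close>
    proof (cases "t \<ge> u")
      case True
      with window_mass_mono[OF this, of y] lower \<open>y \<ge> 1\<close> t \<open>\<sigma> > 0\<close> show ?thesis
        by (simp add: u_def)
    next
      case False
      have "y \<le> exp t * y" using t \<open>y \<ge> 1\<close> mult_right_mono[of 1 "exp t" y] by simp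
      hence "window_mass (u - t) (exp t * y) \<le> 2 * (u - t) + \<sigma>"
        using \<open>y \<ge> Y\<close> False t by (intro Y) (auto simp: u_def)
      with window_mass_add[of t "u - t" y] lower t show ?thesis by simp
    qed
    thus ?thesis unfolding window_mass_def eq by (simp add: y_def t_def)
  qed
  have pair: "\<exists>m. good m \<and> exp l * n \<le> m \<and> m \<le> exp (2 * l) * n \<and>
      mertens_sum (x / n) - mertens_sum (x / m) \<ge> 3 / 2 * ln (m / n) - 4 * \<sigma>"
    if n: "good n" "exp (2 * l) * n \<le> exp T * w" for n :: nat
  proof -
    \<comment> \<open>Single steps may be arbitrarily short and would accumulate error. If the first step goes to the
      largest admissible good number, then two steps together advance by more than \<open>l\<close>.\<close>
    define M where "M = {m. good m \<and> n < m \<and> real m \<le> exp l * n}"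
    have exp2: "exp (2 * l) = exp l * exp l" by (simp flip: exp_add)
    have le: "exp l * n \<le> exp T * w"
      using n \<open>l > 0\<close> by (intro order.trans[OF _ n(2)] mult_right_mono) auto
    have "finite M" by (rule finite_subset[OF _ finite_nats_upto[of "exp l * n"]]) (auto simp: M_def nats_upto_def)
    have "M \<noteq> {}" using ex_good[of n] n(1) le by (auto simp: M_def good_def)
    define m1 where "m1 = Max M"
    have "m1 \<in> M" unfolding m1_def by (rule Max_in) fact+
    hence m1: "good m1" "n < m1" "real m1 \<le> exp l * n" by (auto simp: M_def)
    have "exp l * m1 \<le> exp (2 * l) * n"
      unfolding exp2 mult.assoc by (intro mult_left_mono m1) auto
    with n(2) have "exp l * m1 \<le> exp T * w" by linarith
    then obtain m where m: "good m" "m1 < m" "m \<le> exp l * m1"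
      using ex_good[of m1] m1(1) by (auto simp: good_def)
    have "m \<notin> M"
      using Max_ge[OF \<open>finite M\<close>, of m] m unfolding m1_def by auto
    hence "exp l * n < m" using m m1 by (auto simp: M_def)
    have "ln (m / n) = ln (m1 / n) + ln (m / m1)"
      using m m1 n good_pos by (simp add: ln_div)
    moreover have "mertens_sum (x / n) - mertens_sum (x / m1) \<ge> 3 / 2 * ln (m1 / n) - 2 * \<sigma>"
      using step n(1) m1 by simp
    moreover have "mertens_sum (x / m1) - mertens_sum (x / m) \<ge> 3 / 2 * ln (m / m1) - 2 * \<sigma>"
      using step m1 m by simp
    ultimately have "mertens_sum (x / n) - mertens_sum (x / m) \<ge> 3 / 2 * ln (m / n) - 4 * \<sigma>"
      by (simp add: algebra_simps)
    thus ?thesis using m \<open>exp l * n < m\<close> \<open>exp l * m1 \<le> exp (2 * l) * n\<close> by force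
  qed
  have "exp l * w \<le> exp T * w"
    using \<open>w \<ge> 1\<close> \<open>l > 0\<close> by (intro mult_right_mono) (auto simp: T_def)
  then obtain n0 where n0: "good n0" "n0 \<le> exp l * w" using ex_good[of w] by auto
  \<comment> \<open>The number \<open>m\<close> is the end of a chain of \<open>i\<close> pairs of steps from \<open>n0\<close>.\<close>
  define reaches where "reaches i m \<longleftrightarrow> good m \<and> exp (real i * l) * n0 \<le> real m \<and> real m \<le> exp ((2 * real i + 1) * l) * w \<and>
      3 / 2 * ln (m / n0) - 4 * \<sigma> * i \<le> mertens_sum (x / n0) - mertens_sum (x / m)" for i m :: nat
  have chain: "\<exists>m. reaches i m" if "i \<le> k" for i
    using that
  proof (induction i)
    case 0
    have "reaches 0 n0" using n0 good_pos[OF n0(1)] by (simp add: reaches_def)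
    thus ?case ..
  next
    case (Suc i)
    from Suc.IH[OF Suc_leD[OF Suc.prems]] obtain n where "reaches i n" ..
    hence n: "good n" "exp (real i * l) * n0 \<le> real n" "real n \<le> exp ((2 * real i + 1) * l) * w"
      "3 / 2 * ln (n / n0) - 4 * \<sigma> * i \<le> mertens_sum (x / n0) - mertens_sum (x / n)"
      by (simp_all only: reaches_def)
    have "exp (2 * l) * n \<le> exp (2 * l) * (exp ((2 * real i + 1) * l) * w)"
      by (intro mult_left_mono n) auto
    also have "\<dots> = exp (2 * l + (2 * real i + 1) * l) * w"
      by (simp only: exp_add mult.assoc)
    also have "2 * l + (2 * real i + 1) * l = (2 * real (Suc i) + 1) * l"
      by (simp add: algebra_simps)
    finally have le1: "exp (2 * l) * n \<le> exp ((2 * real (Suc i) + 1) * l) * w" .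
    also have "\<dots> \<le> exp T * w"
      using \<open>w \<ge> 1\<close> Suc.prems \<open>l > 0\<close> by (intro mult_right_mono) (auto simp: T_def)
    finally have le2: "exp (2 * l) * n \<le> exp T * w" .
    from pair[OF n(1) this] obtain m where m: "good m" "exp l * n \<le> m" "m \<le> exp (2 * l) * n"
      "mertens_sum (x / n) - mertens_sum (x / m) \<ge> 3 / 2 * ln (m / n) - 4 * \<sigma>"
      by (elim exE conjE)
    have "exp l * (exp (i * l) * n0) \<le> exp l * n" by (intro mult_left_mono n) auto
    also note m(2)
    also have "exp l * (exp (i * l) * n0) = exp (Suc i * l) * n0"
      by (simp add: exp_add ring_distribs)
    finally have "exp (real (Suc i) * l) * n0 \<le> real m" .
    moreover have "ln (m / n0) = ln (n / n0) + ln (m / n)"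
      using m n n0 good_pos by (simp add: ln_div)
    with m(4) n(4) have "mertens_sum (x / n0) - mertens_sum (x / m) \<ge> 3 / 2 * ln (m / n0) - 4 * \<sigma> * Suc i"
      by (simp add: algebra_simps)
    moreover have "m \<le> exp ((2 * real (Suc i) + 1) * l) * w" using m(3) le1 by linarith
    ultimately have "reaches (Suc i) m" using m(1) unfolding reaches_def by (intro conjI)
    thus ?case ..
  qed
  from chain[OF order.refl] obtain m where "reaches k m" ..
  hence m: "good m" "exp (real k * l) * n0 \<le> real m"
    "3 / 2 * ln (m / n0) - 4 * \<sigma> * k \<le> mertens_sum (x / n0) - mertens_sum (x / m)"
    by (simp_all only: reaches_def)
  have pos: "real n0 > 0" "real m > 0" using good_pos m n0 by auto
  have "exp (k * l) \<le> m / n0" using m(2) pos by (simp add: field_simps)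
  hence ln_ge: "k * l \<le> ln (m / n0)" using pos by (subst ln_ge_iff) auto
  have ge1: "x / n0 \<ge> 1" "x / m \<ge> 1" using ge_Y[OF n0(1)] ge_Y[OF m(1)] Y by auto
  have "ln (x / n0) - ln (x / m) = ln (m / n0)"
    using ge1 pos by (simp add: ln_div zero_less_divide_iff divide_le_eq split: if_splits)
  hence "mertens_sum (x / n0) - mertens_sum (x / m) \<le> ln (m / n0) + 2 * B"
    using B(2)[OF ge1(1)] B(2)[OF ge1(2)] by linarith
  moreover have "4 * \<sigma> * k = k * l / 4" by (simp add: \<sigma>_def)
  ultimately show False using m(3) ln_ge k by linarith
qed

text \<open>
  For long windows this is immediate from Mertens' theorem, and \<open>window_mass_shrink\<close> reduces the length
  geometrically.
\<close>

theorem window_mass_bounded_below: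
  assumes "l > 0"
  shows "\<exists>\<delta>>0. \<exists>X. \<forall>x\<ge>X. window_mass l x \<ge> \<delta>"
proof -
  obtain B where B: "B \<ge> 0" "\<And>x. x \<ge> 1 \<Longrightarrow> \<bar>mertens_sum x - ln x\<bar> \<le> B" by (rule mertens) blast
  define L where "L = 2 * B + 1"
  have "L > 0" using B by (simp add: L_def)
  have *: "\<exists>\<delta>>0. \<exists>X. \<forall>x\<ge>X. window_mass ((3 / 4) ^ k * L) x \<ge> \<delta>" for k :: nat
  proof (induction k)
    case 0
    have "window_mass L x \<ge> 1" if x: "x \<ge> 1" for x
    proof -
      have "exp L * x \<ge> 1" using x \<open>L > 0\<close> mult_mono[of 1 "exp L" 1 x] by simp
      from B(2)[OF this] B(2)[OF x] x show ?thesis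
        by (simp add: window_mass_def ln_mult L_def)
    qed
    thus ?case by (auto intro!: exI[of _ 1])
  next
    case (Suc k)
    then obtain \<delta> X where "\<delta> > 0" "\<And>x. x \<ge> X \<Longrightarrow> window_mass ((3 / 4) ^ k * L) x \<ge> \<delta>" by blast
    from window_mass_shrink[OF _ this] \<open>L > 0\<close> show ?case by (simp add: mult.assoc)
  qed
  obtain k where "(3 / 4 :: real) ^ k < l / L"
    using real_arch_pow_inv[of "l / L" "3 / 4"] assms \<open>L > 0\<close> by auto
  hence k: "(3 / 4) ^ k * L \<le> l" using \<open>L > 0\<close> by (simp add: field_simps)
  obtain \<delta> X where \<delta>: "\<delta> > 0" "\<And>x. x \<ge> X \<Longrightarrow> window_mass ((3 / 4) ^ k * L) x \<ge> \<delta>" using * by blast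
  show ?thesis
  proof (intro exI conjI allI impI)
    fix x assume "x \<ge> max X 0"
    thus "window_mass l x \<ge> \<delta>" using \<delta>(2)[of x] window_mass_mono[OF k, of x] by simp
  qed fact
qed

section \<open>Primes in short intervals\<close>

text \<open>
  Summing \<open>ln p / p ^ k\<close> over \<open>k \<ge> 2\<close> gives at most \<open>2 * ln p / p\<^sup>2\<close>, and
  \<open>ln p \<le> 2 * p powr (1 / 2)\<close>, so the series is dominated by the sum of \<open>4 * n powr (-3 / 2)\<close>.
\<close>

lemma summable_proper_primepow: "summable (\<lambda>n. if prime n then 0 else \<Lambda> n / n)"
proof -
  define f where "f n = (if prime n then 0 else \<Lambda> n / n)" for n
  define h where "h n = 4 * real n powr (-3/2)" for n
  have "summable h" unfolding h_def by (intro summable_mult) (simp add: summable_real_powr_iff)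
  have h_nonneg: "h n \<ge> 0" for n by (simp add: h_def)
  have f_nonneg: "f n \<ge> 0" for n by (simp add: f_def mangoldt_nonneg)
  have "sum f {..<N} \<le> suminf h" for N
  proof -
    define P where "P = {p. prime p \<and> p < N}"
    define g where "g = (\<lambda>(p, k). p ^ (k + 2) :: nat)"
    have "finite P" by (simp add: P_def)
    have "(\<Sum>k<N. (1 / 2 :: real) ^ k) \<le> (\<Sum>k. (1 / 2) ^ k)"
      by (intro sum_le_suminf summable_geometric) auto
    hence geometric: "(\<Sum>k<N. (1 / 2 :: real) ^ k) \<le> 2" by (subst (asm) suminf_geometric) auto
    have "sum f {..<N} = sum f {n\<in>{..<N}. primepow n \<and> \<not> prime n}"
      by (rule sum.mono_neutral_right) (auto simp: f_def mangoldt_def)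
    also have "\<dots> \<le> sum f (g ` (P \<times> {..<N}))"
    proof (rule sum_mono2)
      show "{n \<in> {..<N}. primepow n \<and> \<not> prime n} \<subseteq> g ` (P \<times> {..<N})"
      proof
        fix n assume "n \<in> {n \<in> {..<N}. primepow n \<and> \<not> prime n}"
        hence n: "n < N" "primepow n" "\<not> prime n" by auto
        then obtain p j where pj: "prime p" "j > 0" "n = p ^ j" by (auto simp: primepow_def)
        have "j \<noteq> 1" using n pj by auto
        with pj have j: "j \<ge> 2" by simp
        have p2: "p \<ge> 2" using pj by (simp add: prime_ge_2_nat)
        have "j < 2 ^ j" by simp
        also have "2 ^ j \<le> n" unfolding pj(3) using p2 by (intro power_mono) auto
        finally have "j - 2 < N" using n by simp
        moreover have "p \<le> n" unfolding pj(3) using p2 pj(2) by (intro self_le_power) auto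
        hence "p \<in> P" using n pj by (simp add: P_def)
        moreover have "j - 2 + 2 = j" using j by simp
        hence "n = g (p, j - 2)" unfolding g_def pj(3) case_prod_conv by simp
        ultimately show "n \<in> g ` (P \<times> {..<N})" by blast
      qed
    qed (use \<open>finite P\<close> f_nonneg in auto)
    also have "\<dots> \<le> (\<Sum>z\<in>P \<times> {..<N}. (f \<circ> g) z)"
      using \<open>finite P\<close> f_nonneg by (intro sum_image_le) auto
    also have "\<dots> = (\<Sum>p\<in>P. \<Sum>k<N. f (p ^ (k + 2)))"
      by (subst sum.cartesian_product) (auto simp: g_def intro!: sum.cong)
    also have "\<dots> \<le> (\<Sum>p\<in>P. h p)"
    proof (rule sum_mono)
      fix p assume "p \<in> P"
      hence p: "prime p" "p \<ge> 2" by (auto simp: P_def prime_ge_2_nat)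
      have "(\<Sum>k<N. f (p ^ (k + 2))) \<le> (\<Sum>k<N. ln p / p ^ 2 * (1 / 2) ^ k)"
      proof (rule sum_mono)
        fix k
        have "f (p ^ (k + 2)) \<le> ln p / p ^ (k + 2)"
          using p mangoldt_primepow'[of p "k + 2", where ?'a = real] by (simp add: f_def)
        also have "\<dots> = ln p / p ^ 2 * (1 / p) ^ k"
          by (simp add: power_add power2_eq_square power_divide)
        also have "\<dots> \<le> ln p / p ^ 2 * (1 / 2) ^ k"
          using p by (intro mult_left_mono power_mono) (auto simp: field_simps)
        finally show "f (p ^ (k + 2)) \<le> ln p / p ^ 2 * (1 / 2) ^ k" .
      qed
      also have "\<dots> = ln p / p ^ 2 * (\<Sum>k<N. (1 / 2) ^ k)" by (simp add: sum_distrib_left)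
      also have "\<dots> \<le> ln p / p ^ 2 * 2"
        using p geometric by (intro mult_left_mono) auto
      also have "\<dots> \<le> (p powr (1 / 2) / (1 / 2)) / p ^ 2 * 2"
        using p by (intro mult_right_mono divide_right_mono ln_powr_bound) auto
      also have "\<dots> = h p"
        using p powr_diff[of "real p" "1 / 2" 2] by (simp add: h_def)
      finally show "(\<Sum>k<N. f (p ^ (k + 2))) \<le> h p" .
    qed
    also have "\<dots> \<le> suminf h"
      using \<open>summable h\<close> \<open>finite P\<close> h_nonneg by (intro sum_le_suminf) auto
    finally show ?thesis .
  qed
  hence "summable f" by (intro summableI_nonneg_bounded f_nonneg)
  thus ?thesis unfolding f_def .
qed

text \<open>
  The window of length \<open>ln (1 + \<epsilon>)\<close> has mass bounded below, and proper prime powers can account for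
  only a vanishing part of it.
\<close>

theorem ex_prime_short_interval:
  assumes "\<epsilon> > 0"
  obtains X where "X \<ge> 1" "\<And>x. x \<ge> X \<Longrightarrow> \<exists>p. prime p \<and> x < real p \<and> real p \<le> (1 + \<epsilon>) * x"
proof -
  define f where "f n = (if prime n then 0 else \<Lambda> n / n)" for n
  have "ln (1 + \<epsilon>) > 0" using assms by simp
  then obtain \<delta> X where \<delta>: "\<delta> > 0" "\<And>x. x \<ge> X \<Longrightarrow> window_mass (ln (1 + \<epsilon>)) x \<ge> \<delta>"
    using window_mass_bounded_below by blast
  obtain N where N: "\<And>m n. m \<ge> N \<Longrightarrow> norm (sum f {m..<n}) < \<delta>"
    using summable_proper_primepow \<delta>(1) unfolding summable_Cauchy f_def by blast
  show ?thesis
  proof (rule that)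
    show "max 1 (max X N) \<ge> 1" by simp
    fix x assume "x \<ge> max 1 (max X N)"
    hence x: "x \<ge> 1" "x \<ge> X" "x \<ge> N" by auto
    show "\<exists>p. prime p \<and> x < real p \<and> real p \<le> (1 + \<epsilon>) * x"
    proof (rule ccontr)
      assume none: "\<not> ?thesis"
      define A where "A = nats_upto ((1 + \<epsilon>) * x) - nats_upto x"
      have "x \<le> (1 + \<epsilon>) * x" using x assms by (simp add: algebra_simps)
      hence "window_mass (ln (1 + \<epsilon>)) x = (\<Sum>n\<in>A. \<Lambda> n / n)"
        using assms by (simp add: window_mass_def mertens_sum_diff A_def)
      also have "\<dots> = sum f A"
        by (intro sum.cong refl) (use none in \<open>auto simp: f_def A_def nats_upto_def\<close>)
      also have "\<dots> \<le> sum f {N..<Suc (nat \<lfloor>(1 + \<epsilon>) * x\<rfloor>)}"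
      proof (rule sum_mono2)
        show "A \<subseteq> {N..<Suc (nat \<lfloor>(1 + \<epsilon>) * x\<rfloor>)}"
        proof
          fix n assume "n \<in> A"
          hence "n \<in> nats_upto ((1 + \<epsilon>) * x)" "x < real n" unfolding A_def nats_upto_def by auto
          thus "n \<in> {N..<Suc (nat \<lfloor>(1 + \<epsilon>) * x\<rfloor>)}"
            using x(3) unfolding nats_upto_altdef by auto
        qed
      qed (auto simp: f_def mangoldt_nonneg)
      also have "\<dots> < \<delta>" using N[OF order.refl] unfolding real_norm_def abs_less_iff by blast
      finally show False using \<delta>(2)[OF x(2)] by simp
    qed
  qed
qed

section \<open>Greedy expansion into prime reciprocals\<close>

text \<open>
  If the reciprocals of the primes beyond \<open>N\<close> summed to less than \<open>1 / 2\<close>, then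
  \<open>mertens_sum m\<close> would be at most \<open>ln m / 2\<close> plus a constant, contrary to Mertens' theorem.
\<close>

lemma not_summable_prime_reciprocals: "\<not> summable (\<lambda>n. if prime n then 1 / real n else 0)"
proof
  define f where "f n = (if prime n then 0 else \<Lambda> n / n)" for n
  define g where "g n = (if prime n then 1 / real n else 0)" for n
  assume "summable (\<lambda>n. if prime n then 1 / real n else 0)"
  hence "summable g" unfolding g_def .
  then obtain N where N: "\<And>m n. m \<ge> N \<Longrightarrow> norm (sum g {m..<n}) < 1 / 2"
    unfolding summable_Cauchy by (metis zero_less_divide_1_iff zero_less_numeral)
  have "summable f" using summable_proper_primepow unfolding f_def .
  obtain B where B: "\<And>x. x \<ge> 1 \<Longrightarrow> \<bar>mertens_sum x - ln x\<bar> \<le> B" by (rule mertens) blast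
  define C where "C = (\<Sum>n<N. \<Lambda> n / n) + suminf f"
  have *: "ln (real m) \<le> 2 * (C + B)" if m: "m \<ge> 1" "m \<ge> N" for m :: nat
  proof -
    have "mertens_sum m = (\<Sum>n\<in>{1..m}. \<Lambda> n / n)" by (simp add: mertens_sum_def nats_upto_altdef)
    also have "\<dots> \<le> (\<Sum>n\<in>{..<N} \<union> {N..<Suc m}. \<Lambda> n / n)"
      by (intro sum_mono2) (auto simp: mangoldt_nonneg)
    also have "\<dots> = (\<Sum>n<N. \<Lambda> n / n) + (\<Sum>n\<in>{N..<Suc m}. \<Lambda> n / n)"
      by (rule sum.union_disjoint) auto
    also have "(\<Sum>n\<in>{N..<Suc m}. \<Lambda> n / n) \<le> (\<Sum>n\<in>{N..<Suc m}. f n + ln m * g n)"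
    proof (rule sum_mono)
      fix n assume n: "n \<in> {N..<Suc m}"
      show "\<Lambda> n / n \<le> f n + ln m * g n"
      proof (cases "prime n")
        case True
        hence "ln n \<le> ln m" using n prime_gt_0_nat[OF True] by (intro ln_mono) auto
        thus ?thesis using True by (simp add: f_def g_def divide_right_mono)
      qed (simp add: f_def g_def)
    qed
    also have "\<dots> = sum f {N..<Suc m} + ln m * sum g {N..<Suc m}"
      by (simp only: sum.distrib sum_distrib_left)
    also have "\<dots> \<le> suminf f + ln m * (1 / 2)"
    proof (intro add_mono mult_left_mono)
      show "sum f {N..<Suc m} \<le> suminf f"
        using \<open>summable f\<close> by (intro sum_le_suminf) (auto simp: f_def mangoldt_nonneg)
      show "sum g {N..<Suc m} \<le> 1 / 2"
        using N[of N "Suc m"] unfolding real_norm_def by linarith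
    qed (use m in auto)
    finally have "mertens_sum m \<le> C + ln m / 2" by (simp add: C_def)
    with B[of m] m show ?thesis by simp
  qed
  define m where "m = max N (nat \<lceil>exp (2 * (C + B) + 1)\<rceil>)"
  have "exp (2 * (C + B) + 1) \<le> real m" unfolding m_def by linarith
  moreover from this have "real m > 0" by (rule less_le_trans[OF exp_gt_zero])
  ultimately have "2 * (C + B) + 1 \<le> ln m" by (simp add: ln_ge_iff)
  with *[of m] \<open>real m > 0\<close> show False by (simp add: m_def)
qed

text \<open>
  Add the reciprocals of consecutive primes, beginning with the first one that is at least \<open>X\<close>, and
  stop just before the sum reaches \<open>l\<close>. The remainder is then at most the reciprocal of the next
  prime \<open>q\<close>, which is at least \<open>X\<close> and exceeds all primes used. The bounds are stated in product
  form, as in the hypotheses of \<open>greedy_prime_reciprocals\<close>.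
\<close>

lemma ex_initial_primes:
  fixes l X :: real
  assumes "l > 0"
  obtains S where "finite S" "\<And>p. p \<in> S \<Longrightarrow> prime p" "(\<Sum>p\<in>S. 1 / real p) < l"
    "X * (l - (\<Sum>p\<in>S. 1 / real p)) \<le> 1" "\<And>p. p \<in> S \<Longrightarrow> p * (l - (\<Sum>p\<in>S. 1 / real p)) \<le> 1"
proof -
  define g where "g n = (if prime n then 1 / real n else 0)" for n
  define N where "N = nat \<lceil>X\<rceil>"
  have "\<exists>m. sum g {N..<m} \<ge> l"
  proof (rule ccontr)
    assume "\<not> ?thesis"
    hence less: "sum g {N..<m} < l" for m by (simp add: not_le)
    have "summable g"
    proof (rule summableI_nonneg_bounded)
      fix m
      have "sum g {..<m} \<le> sum g ({..<N} \<union> {N..<m})" by (intro sum_mono2) (auto simp: g_def)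
      also have "\<dots> = sum g {..<N} + sum g {N..<m}" by (rule sum.union_disjoint) auto
      finally show "sum g {..<m} \<le> sum g {..<N} + l" using less[of m] by simp
    qed (auto simp: g_def)
    thus False using not_summable_prime_reciprocals unfolding g_def by simp
  qed
  define m where "m = (LEAST m. sum g {N..<m} \<ge> l)"
  have m: "sum g {N..<m} \<ge> l" unfolding m_def by (rule LeastI_ex) fact
  obtain q where q: "m = Suc q" using m \<open>l > 0\<close> by (cases m) auto
  have less: "sum g {N..<q} < l"
    using not_less_Least[of q "\<lambda>m. sum g {N..<m} \<ge> l"] q by (simp add: m_def[symmetric] not_le)
  have "q \<ge> N" using m q \<open>l > 0\<close> by (cases "q \<ge> N") auto
  hence eq: "sum g {N..<m} = sum g {N..<q} + g q" using q by simp
  have "prime q" using eq less m by (cases "prime q") (auto simp: g_def)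
  define S where "S = {p\<in>{N..<q}. prime p}"
  have sum_S: "(\<Sum>p\<in>S. 1 / real p) = sum g {N..<q}"
    by (rule sum.mono_neutral_cong_left) (auto simp: S_def g_def)
  have r: "l - (\<Sum>p\<in>S. 1 / real p) > 0" "l - (\<Sum>p\<in>S. 1 / real p) \<le> 1 / q"
    using less m eq \<open>prime q\<close> unfolding sum_S by (auto simp: g_def)
  have le: "z * (l - (\<Sum>p\<in>S. 1 / real p)) \<le> 1" if "z \<le> real q" for z
  proof -
    have "z * (l - (\<Sum>p\<in>S. 1 / real p)) \<le> real q * (1 / q)"
      using r that by (intro mult_mono) auto
    thus ?thesis using \<open>prime q\<close> by (simp add: prime_gt_0_nat)
  qed
  show ?thesis
  proof (rule that[of S])
    show "X * (l - (\<Sum>p\<in>S. 1 / real p)) \<le> 1"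
      by (rule le) (use \<open>q \<ge> N\<close> in \<open>unfold N_def, linarith\<close>)
    show "real p * (l - (\<Sum>p\<in>S. 1 / real p)) \<le> 1" if "p \<in> S" for p
      by (rule le) (use that in \<open>auto simp: S_def\<close>)
  qed (use r in \<open>auto simp: S_def\<close>)
qed

text \<open>
  From a remainder \<open>s\<close> subtract the reciprocal of a prime just above \<open>1 / s\<close>. As that prime is at most
  \<open>(1 + 1 / \<Theta>) / s\<close>, the new remainder is positive and at most \<open>s / \<Theta>\<close>. Hence the remainders
  decrease, and the primes grow, at least geometrically with ratio \<open>\<Theta>\<close>.
\<close>

lemma greedy_prime_reciprocals:
  fixes r X \<Theta> :: real
  assumes "\<Theta> \<ge> 2" "X > 0" "r > 0" "X * r \<le> 1"
    and primes: "\<And>x. x \<ge> X \<Longrightarrow> \<exists>p. prime p \<and> x < real p \<and> real p \<le> (1 + 1 / \<Theta>) * x"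
  obtains q :: "nat \<Rightarrow> nat" where "strict_mono q" "\<And>n. prime (q n)" "(\<lambda>n. 1 / real (q n)) sums r"
    "\<And>n. real (q n) * r > \<Theta> ^ n"
proof -
  define next_prime where "next_prime s = (SOME p. prime p \<and> 1 / s < real p \<and> real p \<le> (1 + 1 / \<Theta>) / s)" for s :: real
  have next_prime: "prime (next_prime s)" "1 / s < next_prime s" "next_prime s \<le> (1 + 1 / \<Theta>) / s"
    if "s > 0" "X * s \<le> 1" for s
  proof -
    have "X \<le> 1 / s" using that by (simp add: field_simps)
    from primes[OF this] have "\<exists>p. prime p \<and> 1 / s < real p \<and> real p \<le> (1 + 1 / \<Theta>) / s" by simp
    from someI_ex[OF this] show "prime (next_prime s)" "1 / s < next_prime s" "next_prime s \<le> (1 + 1 / \<Theta>) / s"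
      unfolding next_prime_def by auto
  qed
  define R where "R n = ((\<lambda>s. s - 1 / next_prime s) ^^ n) r" for n :: nat
  define q where "q n = next_prime (R n)" for n
  have R_0: "R 0 = r" and R_Suc: "R (Suc n) = R n - 1 / q n" for n
    by (simp_all add: R_def q_def)
  have shrink: "0 < R (Suc n) \<and> R (Suc n) \<le> R n / \<Theta>" if "0 < R n" "X * R n \<le> 1" for n
  proof -
    note q = next_prime[OF that, folded q_def]
    have q_pos: "real (q n) > 0" using q(1) by (simp add: prime_gt_0_nat)
    have "1 / q n < R n" using q(2) q_pos that by (simp add: field_simps)
    moreover have "R n / (1 + 1 / \<Theta>) \<le> 1 / q n"
      using q(3) q_pos that \<open>\<Theta> \<ge> 2\<close> by (simp add: field_simps)
    moreover have "R n - R n / (1 + 1 / \<Theta>) \<le> R n / \<Theta>"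
      using that \<open>\<Theta> \<ge> 2\<close> by (simp add: field_simps)
    ultimately show ?thesis unfolding R_Suc by linarith
  qed
  have inv: "0 < R n \<and> X * R n \<le> 1" for n
  proof (induction n)
    case 0
    show ?case using assms by (simp add: R_0)
  next
    case (Suc n)
    hence "0 < R (Suc n)" "R (Suc n) \<le> R n / \<Theta>" using shrink by auto
    moreover have "R n / \<Theta> \<le> R n" using Suc \<open>\<Theta> \<ge> 2\<close> by (simp add: field_simps)
    ultimately have "R (Suc n) \<le> R n" by linarith
    hence "X * R (Suc n) \<le> X * R n" using \<open>X > 0\<close> by simp
    with Suc \<open>0 < R (Suc n)\<close> show ?case by simp
  qed
  have R_pos: "R n > 0" and R_step: "R (Suc n) \<le> R n / \<Theta>" for n using inv shrink by blast+
  have q: "prime (q n)" "1 / R n < q n" "q n \<le> (1 + 1 / \<Theta>) / R n" for n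
    unfolding q_def using next_prime inv by blast+
  have R_le: "R n \<le> r / \<Theta> ^ n" for n
  proof (induction n)
    case (Suc n)
    have "R (Suc n) \<le> R n / \<Theta>" by (rule R_step)
    also have "\<dots> \<le> r / \<Theta> ^ n / \<Theta>" using Suc \<open>\<Theta> \<ge> 2\<close> by (intro divide_right_mono) auto
    finally show ?case by (simp add: field_simps)
  qed (simp add: R_0)
  show ?thesis
  proof (rule that)
    show "strict_mono q"
    proof (rule strict_mono_Suc_iff[THEN iffD2], rule allI)
      fix n
      have "1 / \<Theta> \<le> 1" using \<open>\<Theta> \<ge> 2\<close> by simp
      hence "1 + 1 / \<Theta> \<le> \<Theta>" using \<open>\<Theta> \<ge> 2\<close> by linarith
      hence "(1 + 1 / \<Theta>) / R n \<le> \<Theta> / R n"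
        using R_pos[of n] by (intro divide_right_mono) auto
      also have "\<dots> \<le> 1 / R (Suc n)" 
        using R_step[of n] R_pos[of n] R_pos[of "Suc n"] \<open>\<Theta> \<ge> 2\<close> by (simp add: field_simps)
      finally have "real (q n) < real (q (Suc n))" using q(2)[of "Suc n"] q(3)[of n] by linarith
      thus "q n < q (Suc n)" by simp
    qed
    show "prime (q n)" for n by (rule q)
    show "real (q n) * r > \<Theta> ^ n" for n
    proof -
      have "\<Theta> ^ n / r \<le> 1 / R n"
        using R_le[of n] R_pos[of n] \<open>r > 0\<close> \<open>\<Theta> \<ge> 2\<close> by (simp add: field_simps)
      also have "\<dots> < q n" by (rule q)
      finally show ?thesis using \<open>r > 0\<close> by (simp add: field_simps)
    qed
    have partial: "(\<Sum>k<n. 1 / real (q k)) = r - R n" for n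
      by (induction n) (simp_all add: R_0 R_Suc)
    have "R \<longlonglongrightarrow> 0"
    proof (rule tendsto_sandwich)
      show "\<forall>\<^sub>F n in sequentially. 0 \<le> R n" using R_pos by (simp add: less_imp_le)
      show "\<forall>\<^sub>F n in sequentially. R n \<le> r * (1 / \<Theta>) ^ n"
        using R_le by (simp add: power_divide)
      have "(\<lambda>n. (1 / \<Theta>) ^ n) \<longlonglongrightarrow> 0" using \<open>\<Theta> \<ge> 2\<close> by (intro LIMSEQ_realpow_zero) auto
      thus "(\<lambda>n. r * (1 / \<Theta>) ^ n) \<longlonglongrightarrow> 0" by (rule tendsto_mult_right_zero)
    qed simp
    hence "(\<lambda>n. r - R n) \<longlonglongrightarrow> r - 0" by (intro tendsto_intros)
    thus "(\<lambda>n. 1 / real (q n)) sums r" unfolding sums_def partial by simp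
  qed
qed

lemma summable_powr_of_exponential_growth:
  fixes a :: "nat \<Rightarrow> real"
  assumes "c > 0" "\<Theta> > 1" "\<alpha> > 0" and growth: "\<And>k. a k \<ge> c * \<Theta> ^ k"
  shows "summable (\<lambda>k. 1 / a k powr \<alpha>)"
proof (rule summable_comparison_test')
  have "\<Theta> powr - \<alpha> < 1" using assms powr_less_mono[of "- \<alpha>" 0 \<Theta>] by simp
  thus "summable (\<lambda>k. c powr - \<alpha> * (\<Theta> powr - \<alpha>) ^ k)"
    by (intro summable_mult summable_geometric) auto
  fix k
  have "c * \<Theta> ^ k > 0" using assms by simp
  have "1 / a k powr \<alpha> = a k powr - \<alpha>" by (simp add: powr_minus_divide)
  also have "\<dots> \<le> (c * \<Theta> ^ k) powr - \<alpha>"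
    using growth[of k] \<open>c * \<Theta> ^ k > 0\<close> \<open>\<alpha> > 0\<close> by (intro powr_mono2') auto
  also have "\<dots> = c powr - \<alpha> * (\<Theta> powr - \<alpha>) ^ k"
    using assms by (simp add: powr_mult powr_power powr_realpow[symmetric] powr_powr mult.commute)
  finally show "norm (1 / a k powr \<alpha>) \<le> c powr - \<alpha> * (\<Theta> powr - \<alpha>) ^ k" by simp
qed

theorem corollary2:
  fixes l \<theta> :: real
  assumes "l > 0" and "\<theta> > 0"
  shows "\<exists>(p :: nat \<Rightarrow> nat) (c :: real).
           c > 0 \<and>
           strict_mono_on {1..} p \<and>
           (\<forall>k\<ge>1. prime (p k)) \<and>
           (\<lambda>k. 1 / real (p (Suc k))) sums l \<and>
           (\<forall>k\<ge>1. real (p k) \<ge> c * \<theta> ^ k) \<and>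
           (\<forall>\<alpha>::real. \<alpha> > 0 \<longrightarrow> summable (\<lambda>k. 1 / real (p (Suc k)) powr \<alpha>))"
proof -
  \<comment> \<open>A ratio of at least 2 makes the greedy primes increase; growth with the larger ratio implies
    growth with ratio \<open>\<theta>\<close>.\<close>
  define \<Theta> where "\<Theta> = max \<theta> 2"
  have \<Theta>: "\<Theta> \<ge> 2" "\<Theta> \<ge> \<theta>" by (auto simp: \<Theta>_def)
  obtain X where X: "X \<ge> 1" "\<And>x. x \<ge> X \<Longrightarrow> \<exists>p. prime p \<and> x < real p \<and> real p \<le> (1 + 1 / \<Theta>) * x"
    using ex_prime_short_interval[of "1 / \<Theta>"] \<Theta> by auto
  obtain S where S: "finite S" "\<And>p. p \<in> S \<Longrightarrow> prime p" "(\<Sum>p\<in>S. 1 / real p) < l"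
    "X * (l - (\<Sum>p\<in>S. 1 / real p)) \<le> 1" "\<And>p. p \<in> S \<Longrightarrow> p * (l - (\<Sum>p\<in>S. 1 / real p)) \<le> 1"
    using ex_initial_primes[OF \<open>l > 0\<close>] by blast
  define r where "r = l - (\<Sum>p\<in>S. 1 / real p)"
  have r: "r > 0" "X * r \<le> 1" using S by (simp_all add: r_def)
  obtain q where q: "strict_mono q" "\<And>n. prime (q n)" "(\<lambda>n. 1 / real (q n)) sums r"
      "\<And>n. real (q n) * r > \<Theta> ^ n"
    using greedy_prime_reciprocals[OF \<Theta>(1) _ r X(2)] X(1) by auto
  define xs where "xs = sorted_list_of_set S"
  define N where "N = length xs"
  have xs: "sorted xs" "distinct xs" "set xs = S" using S by (simp_all add: xs_def)
  \<comment> \<open>The sequence \<open>a\<close> is indexed from 0; the required one, indexed from 1, is \<open>a (k - 1)\<close>.\<close>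
  define a where "a k = (if k < N then xs ! k else q (k - N))" for k
  have below: "p < q 0" if "p \<in> S" for p
  proof -
    have "p * r < q 0 * r" using S(5)[OF that] q(4)[of 0] by (simp add: r_def)
    thus ?thesis using r by simp
  qed
  have a_mono: "strict_mono a"
  proof (rule strict_mono_Suc_iff[THEN iffD2], rule allI)
    fix k
    consider "Suc k < N" | "Suc k = N" | "k \<ge> N" by linarith
    thus "a k < a (Suc k)"
    proof cases
      case 1
      thus ?thesis using xs by (simp add: a_def N_def sorted_wrt_nth_less strict_sorted_iff)
    next
      case 2
      hence "xs ! k \<in> S" using nth_mem[of k xs] xs by (simp add: N_def)
      thus ?thesis using below 2 by (simp add: a_def)
    next
      case 3
      thus ?thesis using q(1) by (simp add: a_def Suc_diff_le strict_mono_less)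
    qed
  qed
  have a_prime: "prime (a k)" for k
  proof (cases "k < N")
    case True
    hence "xs ! k \<in> S" using nth_mem[of k xs] xs by (simp add: N_def)
    thus ?thesis using True S by (simp add: a_def)
  qed (simp add: a_def q)
  have "(\<lambda>k. 1 / real (a k)) sums (r + (\<Sum>k<N. 1 / real (a k)))"
    using q(3) by (subst sums_iff_shift'[of _ N, symmetric]) (simp add: a_def)
  also have "(\<Sum>k<N. 1 / real (a k)) = (\<Sum>p\<in>S. 1 / real p)"
  proof -
    have "(\<Sum>k<N. 1 / real (a k)) = (\<Sum>k<length xs. 1 / real (xs ! k))"
      by (intro sum.cong) (auto simp: a_def N_def)
    also have "\<dots> = (\<Sum>p\<in>set xs. 1 / real p)"
      using sum.reindex_bij_betw[OF bij_betw_nth[OF xs(2) refl refl]] by simp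
    finally show ?thesis by (simp add: xs)
  qed
  finally have a_sums: "(\<lambda>k. 1 / real (a k)) sums l" by (simp add: r_def)
  \<comment> \<open>The factor \<open>1 / \<Theta> ^ N\<close> pays for the initial block of \<open>N\<close> primes and for the shift of the greedy
    tail by \<open>N\<close>.\<close>
  define c where "c = min 1 (1 / r) / \<Theta> ^ N"
  have c: "c > 0" using r \<Theta> by (simp add: c_def)
  have a_growth: "real (a k) \<ge> c * \<Theta> ^ k" for k
  proof (cases "k < N")
    case True
    have "c * \<Theta> ^ k \<le> 1 / \<Theta> ^ N * \<Theta> ^ N"
      using True \<Theta> r by (intro mult_mono power_increasing) (auto simp: c_def intro: divide_right_mono)
    also have "\<dots> \<le> real (a k)" using \<Theta> prime_gt_0_nat[OF a_prime[of k]] by simp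
    finally show ?thesis .
  next
    case False
    have "c * \<Theta> ^ k = min 1 (1 / r) * \<Theta> ^ (k - N)"
      using False \<Theta> by (simp add: c_def power_diff)
    also have "\<dots> \<le> 1 / r * \<Theta> ^ (k - N)" using \<Theta> by (intro mult_right_mono) auto
    also have "\<dots> \<le> real (a k)" using q(4)[of "k - N"] False r by (simp add: a_def field_simps)
    finally show ?thesis .
  qed
  show ?thesis
  proof (intro exI conjI allI impI)
    show "c / \<Theta> > 0" using c \<Theta> by simp
    show "strict_mono_on {1..} (\<lambda>k. a (k - 1))"
      using a_mono by (auto simp: strict_mono_on_def strict_mono_less)
    show "prime (a (k - 1))" for k by (rule a_prime)
    show "(\<lambda>k. 1 / real (a (Suc k - 1))) sums l" using a_sums by simp
    show "real (a (k - 1)) \<ge> c / \<Theta> * \<theta> ^ k" if "k \<ge> 1" for k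
    proof -
      have "c / \<Theta> * \<theta> ^ k \<le> c / \<Theta> * \<Theta> ^ k"
        using c \<Theta> \<open>\<theta> > 0\<close> by (intro mult_left_mono power_mono) auto
      also have "\<dots> = c * \<Theta> ^ (k - 1)" using that \<Theta> by (cases k) auto
      also have "\<dots> \<le> real (a (k - 1))" by (rule a_growth)
      finally show ?thesis .
    qed
    show "summable (\<lambda>k. 1 / real (a (Suc k - 1)) powr \<alpha>)" if "\<alpha> > 0" for \<alpha> :: real
      using summable_powr_of_exponential_growth[OF c _ that a_growth] \<Theta> by simp
  qed
qed

end
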